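(* Let $A$ be the $\epsilon_0$-algebra, graded by $|x_\alpha|=\delta(\alpha)$. If $J$ is any ideal in $A$ that is generated by a finite set of monomials, then $J=\operatorname{ann}_A^2(J)$. However, there are non-monomial ideals $J$ with $J\neq\operatorname{ann}_A^2(J)$, so $A$ does not satisfy the double annihilator condition, and is not self-injective. Moreover, $A$ is totally incoherent, and the reduced quotient is $$A/\sqrt{0}=\mathbb{F}[x_\alpha\mid\alpha<\epsilon_0]/(x_\alpha x_\beta\mid\alpha\neq\beta).$$
   Context: Rings are $\mathbb{Z}$-graded, unital and commutative; modules are graded; ``element'' and ``ideal'' mean homogeneous element and homogeneous ideal. $\mathbb{F}=\mathbb{Z}/2$. $\epsilon_0$ is the smallest ordinal with $\epsilon_0=\omega^{\epsilon_0}$ (ordinal exponentiation). Every ordinal $\alpha<\epsilon_0$ has a unique Cantor normal form $\alpha=\omega^{\beta_1}n_1+\dotsb+\omega^{\beta_r}n_r$ with the $n_i$ positive integers and $\alpha>\beta_1>\dotsb>\beta_r$. Write $\mu_0(\alpha,\beta)$ for the coefficient of $\omega^\beta$ in the Cantor normal form of $\alpha$ (zero if there is no such term), and put $\mu(\alpha,\beta)=\max(\mu_0(\alpha,\beta),\mu_0(\beta,\alpha))$. The $\epsilon_0$-algebra is $$A=\mathbb{F}[x_\alpha\mid\alpha<\epsilon_0]/(x_\alpha x_\beta^{1+\mu(\alpha,\beta)}\mid\alpha,\beta<\epsilon_0,\ \alpha\neq\beta).$$ The grading is $|x_\alpha|=\delta(\alpha)$, where $\delta\colon\epsilon_0\to\mathbb{N}$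 is defined recursively by $\delta(0)=1$ and $\delta(\alpha)=\left(\sum_t(\delta(\beta_t)+2)n_t\right)-1$ if $\alpha>0$ has Cantor normal form $\alpha=\omega^{\beta_1}n_1+\dotsb+\omega^{\beta_r}n_r$. (For example $\delta(\omega+1)=\delta(\omega^2)=6$.) A monomial is (the image in $A$ of) a finite product of powers of the generators $x_\alpha$; a monomial ideal is an ideal generated by some set of monomials. For an ideal $J$ of a graded ring $R$, $\operatorname{ann}_R(J)=\{a\in R\mid aJ=0\}$ and $\operatorname{ann}_R^2(J)=\operatorname{ann}_R(\operatorname{ann}_R(J))$; $R$ satisfies the double annihilator condition if $\operatorname{ann}_R^2(J)=J$ for all finitely generated ideals $J$. $R$ is self-injective if it is an injective object in the category of graded $R$-modules. A module $M$ is finitely presented if there is an exact sequence $P_1\to P_0\to M\to 0$ with $P_0,P_1$ finitely generated free, i.e. of the form $\bigoplus_{i=1}^r\Sigma^{d_i}R$. $R$ is totally incoherent if the only finitely presented ideals are $0$ and $R$. $\sqrt{0}$ is the ideal of nilpotent elements. *)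

theory Defs
  imports "HOL-Algebra.QuotRing" "HOL-Algebra.Module" "HOL-Library.Z2" "HOL-Library.Poly_Mapping"
begin

section \<open>Ordinals\<close>

text \<open>
  The type of all countable ordinals, that is, the ordinal \<open>\<omega>\<^sub>1\<close>. It is closed under the ordinal
  operations below and it contains \<open>\<epsilon>\<^sub>0\<close>.
\<close>

typedef countable_ordinal = "Field (cardSuc natLeq)"
proof -
  have "infinite (Field (cardSuc natLeq))"
    using natLeq_Card_order by (simp add: cardSuc_finite Field_natLeq)
  then show ?thesis
    using infinite_imp_nonempty by blast
qed

lemma well_order_cardSuc_natLeq: "Well_order (cardSuc natLeq)"
  using cardSuc_Card_order[OF natLeq_Card_order] by (simp add: card_order_on_def)

instantiation countable_ordinal :: wellorder
begin

definition less_eq_countable_ordinal :: "countable_ordinal \<Rightarrow> countable_ordinal \<Rightarrow> bool"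
  where "\<alpha> \<le> \<beta> \<longleftrightarrow> (Rep_countable_ordinal \<alpha>, Rep_countable_ordinal \<beta>) \<in> cardSuc natLeq"

definition less_countable_ordinal :: "countable_ordinal \<Rightarrow> countable_ordinal \<Rightarrow> bool"
  where "\<alpha> < \<beta> \<longleftrightarrow> \<alpha> \<le> \<beta> \<and> \<alpha> \<noteq> (\<beta> :: countable_ordinal)"

instance
proof -
  let ?r = "cardSuc natLeq"
  have ord: "Refl ?r" "trans ?r" "antisym ?r" "Total ?r" and wf: "wf (?r - Id)"
    using well_order_cardSuc_natLeq
    by (auto simp: well_order_on_def linear_order_on_def partial_order_on_def preorder_on_def)
  show "OFCLASS(countable_ordinal, wellorder_class)"
  proof
    fix x y z :: countable_ordinal
    show refl: "x \<le> x"
      using ord(1) Rep_countable_ordinal by (auto simp: less_eq_countable_ordinal_def refl_on_def)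
    show antisym: "x \<le> y \<Longrightarrow> y \<le> x \<Longrightarrow> x = y" for x y :: countable_ordinal
      by (metis ord(3) antisymD Rep_countable_ordinal_inject less_eq_countable_ordinal_def)
    show "(x < y) = (x \<le> y \<and> \<not> y \<le> x)"
      using antisym refl by (auto simp: less_countable_ordinal_def less_eq_countable_ordinal_def)
    show "x \<le> y \<Longrightarrow> y \<le> z \<Longrightarrow> x \<le> z"
      using ord(2) by (auto simp: less_eq_countable_ordinal_def elim: transE)
    show "x \<le> y \<or> y \<le> x"
      using ord(1,4) Rep_countable_ordinal[of x] Rep_countable_ordinal[of y]
      by (cases "x = y") (auto simp: less_eq_countable_ordinal_def total_on_def refl_on_def
          Rep_countable_ordinal_inject)
  next
    fix P :: "countable_ordinal \<Rightarrow> bool" and a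
    assume step: "\<And>x. (\<And>y. y < x \<Longrightarrow> P y) \<Longrightarrow> P x"
    have "wf {(x, y :: countable_ordinal). x < y}"
      by (rule wf_subset[OF wf_inv_image[OF wf, of Rep_countable_ordinal]])
        (auto simp: less_countable_ordinal_def less_eq_countable_ordinal_def inv_image_def
          Rep_countable_ordinal_inject)
    then show "P a"
      by (rule wf_induct_rule) (use step in auto)
  qed
qed

end

text \<open>
  Ordinal arithmetic by transfinite recursion. Each defining formula merges the zero, successor and
  limit clauses of the usual definition. All \<^const>\<open>Least\<close> below exist, since countable sets of
  countable ordinals are bounded.
\<close>

instantiation countable_ordinal :: "{zero, one, plus, times}"
begin

definition zero_countable_ordinal :: countable_ordinal
  where "0 = (LEAST \<alpha> :: countable_ordinal. True)"

definition one_countable_ordinal :: countable_ordinal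
  where "1 = (LEAST \<alpha> :: countable_ordinal. 0 < \<alpha>)"

function plus_countable_ordinal :: "countable_ordinal \<Rightarrow> countable_ordinal \<Rightarrow> countable_ordinal"
  where "\<alpha> + (\<beta> :: countable_ordinal) = (LEAST \<xi>. \<alpha> \<le> \<xi> \<and> (\<forall>\<gamma><\<beta>. \<alpha> + \<gamma> < \<xi>))"
  by pat_completeness auto
termination
  by (relation "inv_image {(\<beta>, \<gamma>). \<beta> < \<gamma>} snd") (simp_all add: wf)

declare plus_countable_ordinal.simps [simp del]

function times_countable_ordinal :: "countable_ordinal \<Rightarrow> countable_ordinal \<Rightarrow> countable_ordinal"
  where "\<alpha> * (\<beta> :: countable_ordinal) = (LEAST \<xi>. \<forall>\<gamma><\<beta>. \<alpha> * \<gamma> + \<alpha> \<le> \<xi>)"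
  by pat_completeness auto
termination
  by (relation "inv_image {(\<beta>, \<gamma>). \<beta> < \<gamma>} snd") (simp_all add: wf)

declare times_countable_ordinal.simps [simp del]

instance ..

end

primrec finite_ordinal :: "nat \<Rightarrow> countable_ordinal"
  where
    "finite_ordinal 0 = 0"
  | "finite_ordinal (Suc n) = finite_ordinal n + 1"

definition ord_omega :: countable_ordinal  (\<open>\<omega>\<close>)
  where "\<omega> = (LEAST \<xi>. \<forall>n. finite_ordinal n < \<xi>)"

function omega_power :: "countable_ordinal \<Rightarrow> countable_ordinal"
  where "omega_power \<beta> = (LEAST \<xi>. 1 \<le> \<xi> \<and> (\<forall>\<gamma><\<beta>. omega_power \<gamma> * \<omega> \<le> \<xi>))"
  by pat_completeness auto
termination
  by (relation "{(\<beta>, \<gamma>). \<beta> < \<gamma>}") (simp_all add: wf)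

declare omega_power.simps [simp del]

definition epsilon_0 :: countable_ordinal  (\<open>\<epsilon>\<^sub>0\<close>)
  where "\<epsilon>\<^sub>0 = (LEAST \<epsilon>. \<epsilon> = omega_power \<epsilon>)"

text \<open>The list \<open>[(\<beta>\<^sub>1, n\<^sub>1), \<dots>, (\<beta>\<^sub>r, n\<^sub>r)]\<close> represents \<open>\<omega>^\<beta>\<^sub>1 n\<^sub>1 + \<dots> + \<omega>^\<beta>\<^sub>r n\<^sub>r\<close>.\<close>

definition is_Cantor_normal_form :: "countable_ordinal \<Rightarrow> (countable_ordinal \<times> nat) list \<Rightarrow> bool"
  where "is_Cantor_normal_form \<alpha> ts \<longleftrightarrow>
    \<alpha> = foldr (\<lambda>(\<beta>, n) \<xi>. omega_power \<beta> * finite_ordinal n + \<xi>) ts 0 \<and>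
    (\<forall>(\<beta>, n) \<in> set ts. n > 0) \<and>
    sorted_wrt (>) (\<alpha> # map fst ts)"

text \<open>The default value is never used below \<open>\<epsilon>\<^sub>0\<close>; it makes the recursion for \<open>\<delta>\<close> total.\<close>

definition Cantor_normal_form :: "countable_ordinal \<Rightarrow> (countable_ordinal \<times> nat) list"
  where "Cantor_normal_form \<alpha> =
    (if \<exists>!ts. is_Cantor_normal_form \<alpha> ts then THE ts. is_Cantor_normal_form \<alpha> ts else [])"

lemma Cantor_normal_form_less:
  assumes "(\<beta>, n) \<in> set (Cantor_normal_form \<alpha>)"
  shows "\<beta> < \<alpha>"
proof (cases "\<exists>!ts. is_Cantor_normal_form \<alpha> ts")
  case True
  then have "is_Cantor_normal_form \<alpha> (Cantor_normal_form \<alpha>)"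
    unfolding Cantor_normal_form_def using theI'[OF True] by simp
  then show ?thesis
    using assms by (force simp: is_Cantor_normal_form_def)
next
  case False
  then show ?thesis
    using assms by (auto simp: Cantor_normal_form_def)
qed

definition mu\<^sub>0 :: "countable_ordinal \<Rightarrow> countable_ordinal \<Rightarrow> nat"
  where "mu\<^sub>0 \<alpha> \<beta> = (case map_of (Cantor_normal_form \<alpha>) \<beta> of None \<Rightarrow> 0 | Some n \<Rightarrow> n)"

definition mu :: "countable_ordinal \<Rightarrow> countable_ordinal \<Rightarrow> nat"
  where "mu \<alpha> \<beta> = max (mu\<^sub>0 \<alpha> \<beta>) (mu\<^sub>0 \<beta> \<alpha>)"

function delta :: "countable_ordinal \<Rightarrow> nat"
  where "delta \<alpha> =
    (if \<alpha> = 0 then 1 else (\<Sum>(\<beta>, n)\<leftarrow>Cantor_normal_form \<alpha>. (delta \<beta> + 2) * n) - 1)"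
  by pat_completeness auto
termination
  by (relation "{(\<beta>, \<gamma>). \<beta> < \<gamma>}") (auto simp: wf intro: Cantor_normal_form_less)

declare delta.simps [simp del]


section \<open>Graded rings and modules\<close>

text \<open>
  A graded ring is given by a ring \<open>R\<close> together with a map \<open>G\<close> sending \<open>d\<close> to the component
  of degree \<open>d\<close>; graded modules \<open>(M, H)\<close> are treated likewise.
\<close>

definition is_grading :: "('m, 'x) ring_scheme \<Rightarrow> (int \<Rightarrow> 'm set) \<Rightarrow> bool"
  where "is_grading M H \<longleftrightarrow>
    (\<forall>d. additive_subgroup (H d) M) \<and>
    (\<forall>x\<in>carrier M. \<exists>!f. (\<forall>d. f d \<in> H d) \<and> finite {d. f d \<noteq> \<zero>\<^bsub>M\<^esub>} \<and>
        x = finsum M f {d. f d \<noteq> \<zero>\<^bsub>M\<^esub>})"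

definition graded_module ::
    "('a, 'x) ring_scheme \<Rightarrow> (int \<Rightarrow> 'a set) \<Rightarrow> ('a, 'm) module \<Rightarrow> (int \<Rightarrow> 'm set) \<Rightarrow> bool"
  where "graded_module R G M H \<longleftrightarrow> module R M \<and> is_grading M H \<and>
    (\<forall>d e. \<forall>a\<in>G d. \<forall>x\<in>H e. a \<odot>\<^bsub>M\<^esub> x \<in> H (d + e))"

text \<open>The morphisms of the category of graded modules, that is, the linear maps of degree 0.\<close>

definition graded_hom ::
    "('a, 'x) ring_scheme \<Rightarrow> ('a, 'm) module \<Rightarrow> (int \<Rightarrow> 'm set) \<Rightarrow>
      ('a, 'n) module \<Rightarrow> (int \<Rightarrow> 'n set) \<Rightarrow> ('m \<Rightarrow> 'n) set"
  where "graded_hom R M H N K =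
    {f \<in> carrier M \<rightarrow> carrier N.
      (\<forall>x\<in>carrier M. \<forall>y\<in>carrier M. f (x \<oplus>\<^bsub>M\<^esub> y) = f x \<oplus>\<^bsub>N\<^esub> f y) \<and>
      (\<forall>a\<in>carrier R. \<forall>x\<in>carrier M. f (a \<odot>\<^bsub>M\<^esub> x) = a \<odot>\<^bsub>N\<^esub> f x) \<and>
      (\<forall>d. f ` H d \<subseteq> K d)}"

definition homogeneous_elements :: "(int \<Rightarrow> 'a set) \<Rightarrow> 'a set"
  where "homogeneous_elements G = (\<Union>d. G d)"

definition homogeneous_ideal :: "('a, 'x) ring_scheme \<Rightarrow> (int \<Rightarrow> 'a set) \<Rightarrow> 'a set \<Rightarrow> bool"
  where "homogeneous_ideal R G J \<longleftrightarrow>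
    ideal J R \<and> J = genideal R (J \<inter> homogeneous_elements G)"

definition finitely_generated_ideal :: "('a, 'x) ring_scheme \<Rightarrow> (int \<Rightarrow> 'a set) \<Rightarrow> 'a set \<Rightarrow> bool"
  where "finitely_generated_ideal R G J \<longleftrightarrow>
    (\<exists>S. finite S \<and> S \<subseteq> homogeneous_elements G \<and> J = genideal R S)"

definition annihilator :: "('a, 'x) ring_scheme \<Rightarrow> 'a set \<Rightarrow> 'a set"
  where "annihilator R J = {a \<in> carrier R. \<forall>j\<in>J. a \<otimes>\<^bsub>R\<^esub> j = \<zero>\<^bsub>R\<^esub>}"

definition double_annihilator_condition :: "('a, 'x) ring_scheme \<Rightarrow> (int \<Rightarrow> 'a set) \<Rightarrow> bool"
  where "double_annihilator_condition R G \<longleftrightarrow>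
    (\<forall>J. finitely_generated_ideal R G J \<longrightarrow> annihilator R (annihilator R J) = J)"

definition nilradical :: "('a, 'x) ring_scheme \<Rightarrow> 'a set"
  where "nilradical R = {a \<in> carrier R. \<exists>n::nat. a [^]\<^bsub>R\<^esub> n = \<zero>\<^bsub>R\<^esub>}"

text \<open>
  An ideal as a module. The fields \<^const>\<open>mult\<close> and \<^const>\<open>one\<close> of the record are not part of the
  module structure.
\<close>

definition ideal_module :: "('a, 'x) ring_scheme \<Rightarrow> 'a set \<Rightarrow> ('a, 'a) module"
  where "ideal_module R J =
    \<lparr>carrier = J, mult = mult R, one = one R, zero = zero R, add = add R, smult = mult R\<rparr>"

definition ideal_grading :: "(int \<Rightarrow> 'a set) \<Rightarrow> 'a set \<Rightarrow> int \<Rightarrow> 'a set"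
  where "ideal_grading G J d = J \<inter> G d"

text \<open>
  Injectivity of \<open>(Q, K)\<close> with respect to monomorphisms between graded modules whose elements are of
  type \<open>'m\<close>; quantification over all graded modules of all types is not possible inside a formula.
\<close>

definition graded_injective ::
    "'m itself \<Rightarrow> ('a, 'x) ring_scheme \<Rightarrow> (int \<Rightarrow> 'a set) \<Rightarrow>
      ('a, 'q) module \<Rightarrow> (int \<Rightarrow> 'q set) \<Rightarrow> bool"
  where "graded_injective (ty :: 'm itself) R G Q K \<longleftrightarrow>
    (\<forall>(M :: ('a, 'm) module) H (N :: ('a, 'm) module) L i f.
      graded_module R G M H \<longrightarrow> graded_module R G N L \<longrightarrow>
      i \<in> graded_hom R M H N L \<longrightarrow> inj_on i (carrier M) \<longrightarrow>
      f \<in> graded_hom R M H Q K \<longrightarrow>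
      (\<exists>g \<in> graded_hom R N L Q K. \<forall>x\<in>carrier M. g (i x) = f x))"

text \<open>
  By the graded form of Baer's criterion it suffices to extend maps defined on homogeneous ideals
  of (shifts of) \<open>R\<close>. Hence nothing is lost by letting the test modules have elements of type \<open>'a\<close>;
  for a negated statement the restriction is in any case harmless.
\<close>

definition self_injective :: "('a, 'x) ring_scheme \<Rightarrow> (int \<Rightarrow> 'a set) \<Rightarrow> bool"
  where "self_injective R G \<longleftrightarrow>
    graded_injective TYPE('a) R G (ideal_module R (carrier R)) G"

text \<open>
  The graded module \<open>\<Sigma>^d\<^sub>1 R \<oplus> \<dots> \<oplus> \<Sigma>^d\<^sub>r R\<close> for \<open>ds = [d\<^sub>1, \<dots>, d\<^sub>r]\<close>, where the degree \<open>k\<close> component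
  of \<open>\<Sigma>^d R\<close> is the degree \<open>k - d\<close> component of \<open>R\<close>.
\<close>

definition free_module :: "('a, 'x) ring_scheme \<Rightarrow> int list \<Rightarrow> ('a, nat \<Rightarrow> 'a) module"
  where "free_module R ds =
    \<lparr>carrier = {..<length ds} \<rightarrow>\<^sub>E carrier R,
     mult = (\<lambda>f g. \<lambda>i\<in>{..<length ds}. f i \<otimes>\<^bsub>R\<^esub> g i),
     one = (\<lambda>i\<in>{..<length ds}. \<one>\<^bsub>R\<^esub>),
     zero = (\<lambda>i\<in>{..<length ds}. \<zero>\<^bsub>R\<^esub>),
     add = (\<lambda>f g. \<lambda>i\<in>{..<length ds}. f i \<oplus>\<^bsub>R\<^esub> g i),
     smult = (\<lambda>a f. \<lambda>i\<in>{..<length ds}. a \<otimes>\<^bsub>R\<^esub> f i)\<rparr>"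

definition free_grading :: "(int \<Rightarrow> 'a set) \<Rightarrow> int list \<Rightarrow> int \<Rightarrow> (nat \<Rightarrow> 'a) set"
  where "free_grading G ds k = (\<Pi>\<^sub>E i\<in>{..<length ds}. G (k - ds ! i))"

definition finitely_presented ::
    "('a, 'x) ring_scheme \<Rightarrow> (int \<Rightarrow> 'a set) \<Rightarrow> ('a, 'm) module \<Rightarrow> (int \<Rightarrow> 'm set) \<Rightarrow> bool"
  where "finitely_presented R G M H \<longleftrightarrow>
    (\<exists>es ds.
      \<exists>\<phi> \<in> graded_hom R (free_module R es) (free_grading G es) (free_module R ds) (free_grading G ds).
      \<exists>\<psi> \<in> graded_hom R (free_module R ds) (free_grading G ds) M H.
        \<phi> ` carrier (free_module R es) = {x \<in> carrier (free_module R ds). \<psi> x = \<zero>\<^bsub>M\<^esub>} \<and>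
        \<psi> ` carrier (free_module R ds) = carrier M)"

definition totally_incoherent :: "('a, 'x) ring_scheme \<Rightarrow> (int \<Rightarrow> 'a set) \<Rightarrow> bool"
  where "totally_incoherent R G \<longleftrightarrow>
    {J. homogeneous_ideal R G J \<and> finitely_presented R G (ideal_module R J) (ideal_grading G J)}
      = {{\<zero>\<^bsub>R\<^esub>}, carrier R}"

definition quotient_grading ::
    "('a, 'x) ring_scheme \<Rightarrow> 'a set \<Rightarrow> (int \<Rightarrow> 'a set) \<Rightarrow> int \<Rightarrow> 'a set set"
  where "quotient_grading R I G d = (\<lambda>a. I +>\<^bsub>R\<^esub> a) ` G d"

definition graded_ring_iso ::
    "('a, 'x) ring_scheme \<Rightarrow> (int \<Rightarrow> 'a set) \<Rightarrow> ('b, 'y) ring_scheme \<Rightarrow> (int \<Rightarrow> 'b set) \<Rightarrow> ('a \<Rightarrow> 'b) set"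
  where "graded_ring_iso R G S K = {\<phi> \<in> ring_iso R S. \<forall>d. \<phi> ` G d = K d}"


section \<open>The \<open>\<epsilon>\<^sub>0\<close>-algebra\<close>

text \<open>
  A polynomial over \<open>\<bbbF> = \<int>/2\<close> is a finitely supported map from exponent vectors to coefficients; an
  exponent vector is a finitely supported map from variables to exponents.
\<close>

type_synonym exponents = "countable_ordinal \<Rightarrow>\<^sub>0 nat"
type_synonym polynomial = "exponents \<Rightarrow>\<^sub>0 bit"

definition monom :: "exponents \<Rightarrow> polynomial"
  where "monom m = Poly_Mapping.single m 1"

definition var :: "countable_ordinal \<Rightarrow> polynomial"
  where "var \<alpha> = monom (Poly_Mapping.single \<alpha> 1)"

definition eps0_exponents :: "exponents set"
  where "eps0_exponents = {m. Poly_Mapping.keys m \<subseteq> {..<\<epsilon>\<^sub>0}}"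

definition poly_ring :: "polynomial ring"
  where "poly_ring =
    \<lparr>carrier = {p. Poly_Mapping.keys p \<subseteq> eps0_exponents},
     mult = (*), one = 1, zero = 0, add = (+)\<rparr>"

definition exponents_degree :: "exponents \<Rightarrow> int"
  where "exponents_degree m =
    (\<Sum>\<alpha>\<in>Poly_Mapping.keys m. int (Poly_Mapping.lookup m \<alpha> * delta \<alpha>))"

definition poly_grading :: "int \<Rightarrow> polynomial set"
  where "poly_grading d =
    {p \<in> carrier poly_ring. \<forall>m\<in>Poly_Mapping.keys p. exponents_degree m = d}"

definition eps0_relations :: "polynomial set"
  where "eps0_relations =
    {var \<alpha> * var \<beta> ^ (1 + mu \<alpha> \<beta>) | \<alpha> \<beta>. \<alpha> < \<epsilon>\<^sub>0 \<and> \<beta> < \<epsilon>\<^sub>0 \<and> \<alpha> \<noteq> \<beta>}"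

definition eps0_ideal :: "polynomial set"
  where "eps0_ideal = genideal poly_ring eps0_relations"

definition eps0_algebra :: "polynomial set ring"
  where "eps0_algebra = poly_ring Quot eps0_ideal"

definition eps0_grading :: "int \<Rightarrow> polynomial set set"
  where "eps0_grading = quotient_grading poly_ring eps0_ideal poly_grading"

definition eps0_monomials :: "polynomial set set"
  where "eps0_monomials = {eps0_ideal +>\<^bsub>poly_ring\<^esub> monom m | m. m \<in> eps0_exponents}"

definition monomial_ideal :: "polynomial set set \<Rightarrow> bool"
  where "monomial_ideal J \<longleftrightarrow> (\<exists>S \<subseteq> eps0_monomials. J = genideal eps0_algebra S)"

definition eps0_var :: "countable_ordinal \<Rightarrow> polynomial set"
  where "eps0_var \<alpha> = eps0_ideal +>\<^bsub>poly_ring\<^esub> var \<alpha>"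

text \<open>The algebra \<open>\<bbbF>[x\<^sub>\<alpha> | \<alpha> < \<epsilon>\<^sub>0] / (x\<^sub>\<alpha> x\<^sub>\<beta> | \<alpha> \<noteq> \<beta>)\<close>.\<close>

definition reduced_ideal :: "polynomial set"
  where "reduced_ideal =
    genideal poly_ring {var \<alpha> * var \<beta> | \<alpha> \<beta>. \<alpha> < \<epsilon>\<^sub>0 \<and> \<beta> < \<epsilon>\<^sub>0 \<and> \<alpha> \<noteq> \<beta>}"

definition reduced_algebra :: "polynomial set ring"
  where "reduced_algebra = poly_ring Quot reduced_ideal"

definition reduced_grading :: "int \<Rightarrow> polynomial set set"
  where "reduced_grading = quotient_grading poly_ring reduced_ideal poly_grading"

definition reduced_var :: "countable_ordinal \<Rightarrow> polynomial set"
  where "reduced_var \<alpha> = reduced_ideal +>\<^bsub>poly_ring\<^esub> var \<alpha>"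

end

theory Submission
  imports Defs "HOL-Library.Countable_Set_Type"
begin

text \<open>
  The proof rests on one property of Cantor normal forms, a weighted version of the extension
  property of the Rado graph: for a finite set \<open>T\<close> of ordinals below \<open>\<epsilon>\<^sub>0\<close> and prescribed numbers
  \<open>k \<beta>\<close> there is \<open>\<gamma> < \<epsilon>\<^sub>0\<close> outside \<open>T\<close> with \<open>\<mu>(\<gamma>, \<beta>) = k \<beta>\<close> for all \<open>\<beta> \<in> T\<close>
  (\<open>ordinal_with_prescribed_mu\<close>). One takes \<open>\<gamma> = \<omega>^\<eta> + \<Sum>\<beta>. \<omega>^\<beta> (k \<beta>)\<close> with \<open>\<eta>\<close> above \<open>T\<close>: since \<open>\<gamma>\<close>
  exceeds every \<open>\<beta> \<in> T\<close>, it does not occur as an exponent in \<open>\<beta>\<close>, and \<open>\<mu>(\<gamma>, \<beta>)\<close> is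
  read off from the normal form of \<open>\<gamma>\<close>. The function \<open>\<delta>\<close> enters through its positivity, by which
  the component of degree \<open>0\<close> consists of the constants.

  As the relations are monomials, the algebra has a basis of \<^emph>\<open>standard\<close> monomials, and all
  questions are decided by comparing coefficients of standard monomials (\<open>cls_eq_iff\<close>).

  \<^emph>\<open>Monomial ideals.\<close> Let \<open>J\<close> be generated by finitely many monomials and let \<open>m\<close> be a standard
  monomial that none of them divides. Choose \<open>\<gamma>\<close> such that \<open>\<mu>(\<gamma>, \<beta>)\<close> is the exponent of
  \<open>x\<^sub>\<beta>\<close> in \<open>m\<close> for all variables involved. Then \<open>x\<^sub>\<gamma> m \<noteq> 0\<close>, whereas \<open>x\<^sub>\<gamma> n = 0\<close> for every
  monomial \<open>n\<close> that does not divide \<open>m\<close> (\<open>separating_variable\<close>). So \<open>x\<^sub>\<gamma>\<close> annihilates \<open>J\<close>, but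
  no element in which \<open>m\<close> occurs.

  \<^emph>\<open>The counterexample.\<close> Let \<open>u = x\<^sub>0^k + x\<^sub>1^l\<close> be homogeneous with \<open>k\<close> and \<open>l\<close> so large that
  \<open>x\<^sub>0^k x\<^sub>1^l = 0\<close>. In a product \<open>q u\<close> no nonzero terms of \<open>q x\<^sub>0^k\<close> and \<open>q x\<^sub>1^l\<close> can cancel, so
  \<open>q u = 0\<close> implies \<open>q x\<^sub>0^k = 0\<close>. Hence \<open>x\<^sub>0^k\<close> lies in the double annihilator of \<open>(u)\<close>, but it is
  not a multiple of \<open>u\<close>. For the same reason \<open>q u \<mapsto> q x\<^sub>0^k\<close> is a well-defined map from \<open>(u)\<close> to
  the algebra; it does not extend to the algebra, because an extension sends \<open>1\<close> to some \<open>c\<close> with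
  \<open>c u = x\<^sub>0^k\<close>.

  \<^emph>\<open>Incoherence.\<close> Let a proper nonzero ideal have homogeneous generators \<open>u\<^sub>1, \<dots>, u\<^sub>r\<close> and
  finitely many generating relations \<open>k\<^sub>1, \<dots>, k\<^sub>s\<close>. Let \<open>x\<^sub>\<gamma>\<close> annihilate all the variables that
  occur in these data. As the \<open>u\<^sub>l\<close> have no constant term, \<open>x\<^sub>\<gamma> e\<^sub>i\<close> is a relation for every \<open>i\<close>,
  say \<open>x\<^sub>\<gamma> e\<^sub>i = \<Sum>j. c\<^sub>j k\<^sub>j\<close>. Comparison of the coefficients of \<open>x\<^sub>\<gamma>\<close> shows that
  \<open>\<Sum>j. g\<^sub>j k\<^sub>j\<close>, where \<open>g\<^sub>j \<in> \<bbbF>\<close> is the coefficient of \<open>x\<^sub>\<gamma>\<close> in \<open>c\<^sub>j\<close>, is a relation with constant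
  part \<open>e\<^sub>i\<close>. It expresses \<open>u\<^sub>i\<close> by terms of larger degree if \<open>u\<^sub>i\<close> contains a monomial of the least
  degree that occurs at all, a contradiction (\<open>finitely_presented_trivial\<close>).

  \<^emph>\<open>The reduced quotient.\<close> In characteristic 2 the power \<open>p^(2^j)\<close> is the sum of the powers
  \<open>m^(2^j)\<close> of the monomials \<open>m\<close> of \<open>p\<close>. So \<open>p\<close> is nilpotent in the algebra if and only if all its
  monomials are, which means that each of them involves at least two variables.
\<close>

section \<open>Ordinal arithmetic\<close>

lemma countable_lessThan_countable_ordinal: "countable {..<\<alpha> :: countable_ordinal}"
proof -
  let ?r = "cardSuc natLeq"
  have inj: "inj_on Rep_countable_ordinal {..<\<alpha>}"
    by (simp add: inj_on_def Rep_countable_ordinal_inject)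
  have sub: "Rep_countable_ordinal ` {..<\<alpha>} \<subseteq> underS ?r (Rep_countable_ordinal \<alpha>)"
    by (auto simp: underS_def less_countable_ordinal_def less_eq_countable_ordinal_def
        Rep_countable_ordinal_inject)
  have "(card_of (underS ?r (Rep_countable_ordinal \<alpha>)), ?r) \<in> ordLess"
    by (rule card_of_underS[OF cardSuc_Card_order[OF natLeq_Card_order] Rep_countable_ordinal])
  then have "(card_of (underS ?r (Rep_countable_ordinal \<alpha>)), natLeq) \<in> ordLeq"
    by (simp add: cardSuc_ordLeq_ordLess natLeq_Card_order card_of_Card_order)
  then have "countable (underS ?r (Rep_countable_ordinal \<alpha>))"
    using countable_card_le_natLeq by blast
  with sub have "countable (Rep_countable_ordinal ` {..<\<alpha>})"
    by (rule countable_subset)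
  then show ?thesis
    using inj by (rule countable_image_inj_on)
qed

lemma uncountable_countable_ordinal: "\<not> countable (UNIV :: countable_ordinal set)"
proof
  let ?r = "cardSuc natLeq"
  assume "countable (UNIV :: countable_ordinal set)"
  moreover have "range Rep_countable_ordinal = Field ?r"
    using type_definition.Rep_range[OF type_definition_countable_ordinal] .
  ultimately have "countable (Field ?r)"
    by (metis countable_image)
  then have "(card_of (Field ?r), natLeq) \<in> ordLeq"
    using countable_card_le_natLeq by blast
  moreover have "(card_of (Field ?r), ?r) \<in> ordIso"
    by (rule card_of_Field_ordIso[OF cardSuc_Card_order[OF natLeq_Card_order]])
  ultimately show False
    using cardSuc_greater[OF natLeq_Card_order]
    by (meson not_ordLess_ordLeq ordIso_iff_ordLeq ordLeq_transitive)
qed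

text \<open>
  The type has the order type of \<open>\<omega>\<^sub>1\<close>: it is uncountable, but its initial segments are countable.
  This bound is what makes every \<^const>\<open>Least\<close> in the definitions of the operations exist.
\<close>

lemma countable_strict_upper_bound:
  assumes "countable (S :: countable_ordinal set)"
  shows "\<exists>\<xi>. \<forall>\<sigma>\<in>S. \<sigma> < \<xi>"
proof (rule ccontr)
  assume "\<not> ?thesis"
  then have "UNIV \<subseteq> (\<Union>\<sigma>\<in>S. insert \<sigma> {..<\<sigma>})"
    by (force simp: not_less order_le_less)
  moreover have "countable (\<Union>\<sigma>\<in>S. insert \<sigma> {..<\<sigma>})"
    using assms countable_lessThan_countable_ordinal by simp
  ultimately show False
    using uncountable_countable_ordinal countable_subset by blast
qed

lemma countable_image_bound:
  "\<exists>\<xi>. \<forall>\<gamma><\<beta>. (f \<gamma> :: countable_ordinal) < \<xi>" for \<beta> :: countable_ordinal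
  using countable_strict_upper_bound[OF countable_image[OF countable_lessThan_countable_ordinal, of f \<beta>]]
  by auto

lemma ordinal_zero_le [simp]: "0 \<le> (\<alpha> :: countable_ordinal)"
  by (simp add: zero_countable_ordinal_def Least_le)

lemma ordinal_not_less_zero [simp]: "\<not> (\<alpha> :: countable_ordinal) < 0"
  by (simp add: not_less)

lemma ordinal_one_pos: "0 < (1 :: countable_ordinal)"
proof -
  obtain \<xi> :: countable_ordinal where "0 < \<xi>"
    using countable_strict_upper_bound[of "{0}"] by auto
  then show ?thesis
    unfolding one_countable_ordinal_def by (rule LeastI)
qed

lemma ordinal_pos_iff: "0 < \<alpha> \<longleftrightarrow> \<alpha> \<noteq> (0 :: countable_ordinal)"
  using ordinal_zero_le[of \<alpha>] by (auto simp: order_le_less)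

lemma ordinal_less_one_iff [simp]: "\<alpha> < 1 \<longleftrightarrow> \<alpha> = (0 :: countable_ordinal)"
proof
  assume "\<alpha> < 1"
  then have "\<not> 0 < \<alpha>"
    unfolding one_countable_ordinal_def by (rule not_less_Least)
  then show "\<alpha> = 0" by (simp add: ordinal_pos_iff)
qed (simp add: ordinal_one_pos)

lemma ordinal_plus_exists: "\<exists>\<xi>. \<alpha> \<le> \<xi> \<and> (\<forall>\<gamma><\<beta>. \<alpha> + \<gamma> < \<xi>)" for \<alpha> \<beta> :: countable_ordinal
proof -
  obtain \<xi> where "\<forall>\<gamma><\<beta>. \<alpha> + \<gamma> < \<xi>"
    using countable_image_bound[of \<beta> "\<lambda>\<gamma>. \<alpha> + \<gamma>"] by blast
  then show ?thesis
    by (intro exI[of _ "max \<alpha> \<xi>"]) (auto simp: less_max_iff_disj)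
qed

lemma
  fixes \<alpha> \<beta> :: countable_ordinal
  shows ordinal_plus_ge: "\<alpha> \<le> \<alpha> + \<beta>"
    and ordinal_plus_strict_mono: "\<gamma> < \<beta> \<Longrightarrow> \<alpha> + \<gamma> < \<alpha> + \<beta>"
  using LeastI_ex[OF ordinal_plus_exists[of \<alpha> \<beta>]] by (simp_all add: plus_countable_ordinal.simps[of \<alpha> \<beta>])

lemma ordinal_plus_least:
  fixes \<alpha> \<beta> :: countable_ordinal
  assumes "\<alpha> \<le> \<xi>" "\<And>\<gamma>. \<gamma> < \<beta> \<Longrightarrow> \<alpha> + \<gamma> < \<xi>"
  shows "\<alpha> + \<beta> \<le> \<xi>"
  unfolding plus_countable_ordinal.simps[of \<alpha> \<beta>] using assms by (auto intro: Least_le)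

lemma ordinal_plus_less_iff: "\<alpha> + \<gamma> < \<alpha> + \<beta> \<longleftrightarrow> \<gamma> < (\<beta> :: countable_ordinal)"
  by (rule strict_mono_less) (simp add: strict_monoI ordinal_plus_strict_mono)

lemma ordinal_plus_cancel: "\<alpha> + \<gamma> = \<alpha> + \<beta> \<longleftrightarrow> \<gamma> = (\<beta> :: countable_ordinal)"
  by (metis linorder_neqE order_less_irrefl ordinal_plus_strict_mono)

lemma ordinal_plus_zero [simp]: "\<alpha> + 0 = (\<alpha> :: countable_ordinal)"
  by (rule antisym) (auto intro: ordinal_plus_least ordinal_plus_ge)

lemma ordinal_le_plus: "\<beta> \<le> \<alpha> + (\<beta> :: countable_ordinal)"
proof (induction \<beta> rule: less_induct)
  case (less \<beta>)
  show ?case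
  proof (rule ccontr)
    assume "\<not> ?thesis"
    then have "\<alpha> + \<beta> < \<beta>" by simp
    from less[OF this] ordinal_plus_strict_mono[OF this, of \<alpha>] show False by simp
  qed
qed

lemma ordinal_zero_plus [simp]: "0 + \<beta> = (\<beta> :: countable_ordinal)"
proof (induction \<beta> rule: less_induct)
  case (less \<beta>)
  then show ?case
    by (intro antisym ordinal_plus_least ordinal_le_plus) simp_all
qed

lemma ordinal_less_plus_one_iff: "\<beta> < \<alpha> + 1 \<longleftrightarrow> \<beta> \<le> (\<alpha> :: countable_ordinal)"
proof
  assume "\<beta> < \<alpha> + 1"
  then show "\<beta> \<le> \<alpha>"
    using ordinal_plus_least[of \<alpha> \<beta> 1] by (metis linear not_le ordinal_less_one_iff ordinal_plus_zero order_le_less)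
next
  assume "\<beta> \<le> \<alpha>"
  also have "\<alpha> < \<alpha> + 1"
    using ordinal_plus_strict_mono[OF ordinal_one_pos, of \<alpha>] by simp
  finally show "\<beta> < \<alpha> + 1" .
qed

lemma ordinal_times_exists: "\<exists>\<xi>. \<forall>\<gamma><\<beta>. \<alpha> * \<gamma> + \<alpha> \<le> \<xi>" for \<alpha> \<beta> :: countable_ordinal
  using countable_image_bound[of \<beta> "\<lambda>\<gamma>. \<alpha> * \<gamma> + \<alpha>"] by (meson order_less_imp_le)

lemma ordinal_times_step: "\<gamma> < \<beta> \<Longrightarrow> \<alpha> * \<gamma> + \<alpha> \<le> \<alpha> * (\<beta> :: countable_ordinal)"
  using LeastI_ex[OF ordinal_times_exists[of \<beta> \<alpha>]] by (simp add: times_countable_ordinal.simps[of \<alpha> \<beta>])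

lemma ordinal_times_least:
  fixes \<alpha> \<beta> :: countable_ordinal
  assumes "\<And>\<gamma>. \<gamma> < \<beta> \<Longrightarrow> \<alpha> * \<gamma> + \<alpha> \<le> \<xi>"
  shows "\<alpha> * \<beta> \<le> \<xi>"
  unfolding times_countable_ordinal.simps[of \<alpha> \<beta>] using assms by (auto intro: Least_le)

lemma ordinal_times_mono: "\<gamma> \<le> \<beta> \<Longrightarrow> \<alpha> * \<gamma> \<le> \<alpha> * (\<beta> :: countable_ordinal)"
  by (metis order.trans order_le_less ordinal_plus_ge ordinal_times_step)

lemma ordinal_times_zero [simp]: "\<alpha> * 0 = (0 :: countable_ordinal)"
  by (rule antisym) (auto intro: ordinal_times_least)

lemma ordinal_plus_mono_left: "\<alpha> \<le> \<beta> \<Longrightarrow> \<alpha> + \<gamma> \<le> \<beta> + (\<gamma> :: countable_ordinal)"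
proof (induction \<gamma> rule: less_induct)
  case (less \<gamma>)
  show ?case
  proof (rule ordinal_plus_least)
    show "\<alpha> \<le> \<beta> + \<gamma>" using less.prems ordinal_plus_ge order.trans by blast
    fix \<delta> assume "\<delta> < \<gamma>"
    then show "\<alpha> + \<delta> < \<beta> + \<gamma>"
      using less ordinal_plus_strict_mono order.strict_trans1 by blast
  qed
qed

lemma ordinal_times_plus_one: "\<alpha> * (\<beta> + 1) = \<alpha> * \<beta> + (\<alpha> :: countable_ordinal)"
proof (rule antisym)
  show "\<alpha> * (\<beta> + 1) \<le> \<alpha> * \<beta> + \<alpha>"
    by (rule ordinal_times_least)
      (simp add: ordinal_less_plus_one_iff ordinal_plus_mono_left ordinal_times_mono)
  show "\<alpha> * \<beta> + \<alpha> \<le> \<alpha> * (\<beta> + 1)"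
    by (rule ordinal_times_step) (simp add: ordinal_less_plus_one_iff)
qed

lemma ordinal_times_one [simp]: "\<alpha> * 1 = (\<alpha> :: countable_ordinal)"
  using ordinal_times_plus_one[of \<alpha> 0] by simp

lemma finite_ordinal_mono: "m \<le> n \<Longrightarrow> finite_ordinal m \<le> finite_ordinal n"
  by (induction rule: dec_induct) (auto intro: order.trans ordinal_plus_ge)

lemma finite_ordinal_less_omega: "finite_ordinal n < \<omega>"
proof -
  have "\<exists>\<xi>. \<forall>n. finite_ordinal n < \<xi>"
    using countable_strict_upper_bound[of "range finite_ordinal"] by auto
  from LeastI_ex[OF this] show ?thesis by (simp add: ord_omega_def)
qed

lemma less_omega_finite:
  assumes "\<beta> < \<omega>"
  shows "\<exists>n. \<beta> = finite_ordinal n"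
proof -
  have "\<exists>n. \<beta> \<le> finite_ordinal n"
    using assms not_less_Least[of \<beta> "\<lambda>\<xi>. \<forall>n. finite_ordinal n < \<xi>"]
    by (auto simp: ord_omega_def not_less)
  then show ?thesis
  proof (rule exE)
    fix n show "\<beta> \<le> finite_ordinal n \<Longrightarrow> ?thesis"
    proof (induction n)
      case 0
      then show ?case by (metis antisym finite_ordinal.simps(1) ordinal_zero_le)
    next
      case (Suc n)
      then show ?case by (metis finite_ordinal.simps(2) order_le_less ordinal_less_plus_one_iff)
    qed
  qed
qed

lemma omega_power_exists: "\<exists>\<xi>. 1 \<le> \<xi> \<and> (\<forall>\<gamma><\<beta>. omega_power \<gamma> * \<omega> \<le> \<xi>)"
proof -
  obtain \<xi> where "\<forall>\<gamma><\<beta>. omega_power \<gamma> * \<omega> < \<xi>"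
    using countable_image_bound[of \<beta> "\<lambda>\<gamma>. omega_power \<gamma> * \<omega>"] by blast
  then show ?thesis
    by (intro exI[of _ "max 1 \<xi>"]) (auto simp: le_max_iff_disj order_less_imp_le)
qed

lemma
  shows omega_power_ge_one: "1 \<le> omega_power \<beta>"
    and omega_power_step: "\<gamma> < \<beta> \<Longrightarrow> omega_power \<gamma> * \<omega> \<le> omega_power \<beta>"
  using LeastI_ex[OF omega_power_exists[of \<beta>]] by (simp_all add: omega_power.simps[of \<beta>])

lemma omega_power_least:
  assumes "1 \<le> \<xi>" "\<And>\<gamma>. \<gamma> < \<beta> \<Longrightarrow> omega_power \<gamma> * \<omega> \<le> \<xi>"
  shows "omega_power \<beta> \<le> \<xi>"
  unfolding omega_power.simps[of \<beta>] using assms by (auto intro: Least_le)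

lemma omega_power_zero [simp]: "omega_power 0 = 1"
  by (rule antisym) (auto intro: omega_power_least omega_power_ge_one)

lemma omega_power_pos: "0 < omega_power \<beta>"
  using ordinal_one_pos omega_power_ge_one by (rule order.strict_trans2)

lemma omega_power_times_less:
  assumes "\<gamma> < \<beta>"
  shows "omega_power \<gamma> * finite_ordinal n + omega_power \<gamma> \<le> omega_power \<beta>"
  using ordinal_times_step[OF finite_ordinal_less_omega] omega_power_step[OF assms] order.trans by blast

lemma omega_power_strict_mono: 
  assumes "\<gamma> < \<beta>"
  shows "omega_power \<gamma> < omega_power \<beta>"
proof -
  have "omega_power \<gamma> < omega_power \<gamma> + omega_power \<gamma>"
    using ordinal_plus_strict_mono[OF omega_power_pos, of "omega_power \<gamma>" \<gamma>] by simp
  with omega_power_times_less[OF assms, of 1] show ?thesis by simp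
qed

lemma omega_power_less_iff: "omega_power \<gamma> < omega_power \<beta> \<longleftrightarrow> \<gamma> < \<beta>"
  by (rule strict_mono_less) (simp add: strict_monoI omega_power_strict_mono)

lemma le_omega_power: "\<beta> \<le> omega_power \<beta>"
proof (induction \<beta> rule: less_induct)
  case (less \<beta>)
  show ?case
  proof (rule ccontr)
    assume "\<not> ?thesis"
    then have "omega_power \<beta> < \<beta>" by simp
    from less[OF this] omega_power_strict_mono[OF this] show False by simp
  qed
qed

text \<open>
  The supremum of the tower \<open>0, \<omega>^0, \<omega>^(\<omega>^0), \<dots>\<close> is a fixed point, so that a least one exists.
\<close>

lemma epsilon_0_fixed: "omega_power \<epsilon>\<^sub>0 = \<epsilon>\<^sub>0"
proof -
  define a where "a n = (omega_power ^^ n) 0" for n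
  have a_Suc: "a (Suc n) = omega_power (a n)" for n by (simp add: a_def)
  have "\<exists>\<xi>. \<forall>n. a n \<le> \<xi>"
    using countable_strict_upper_bound[of "range a"] by (auto intro: order_less_imp_le)
  then have \<epsilon>: "\<forall>n. a n \<le> (LEAST \<xi>. \<forall>n. a n \<le> \<xi>)" (is "\<forall>n. a n \<le> ?\<epsilon>")
    by (rule LeastI_ex)
  have "omega_power ?\<epsilon> \<le> ?\<epsilon>"
  proof (rule omega_power_least)
    show "1 \<le> ?\<epsilon>" using spec[OF \<epsilon>, of 1] by (simp add: a_def)
    fix \<gamma> assume "\<gamma> < ?\<epsilon>"
    then have "\<not> (\<forall>n. a n \<le> \<gamma>)" by (rule not_less_Least)
    then obtain n where "\<gamma> < a n" by (auto simp: not_le)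
    from omega_power_step[OF this] spec[OF \<epsilon>, of "Suc n"] show "omega_power \<gamma> * \<omega> \<le> ?\<epsilon>"
      unfolding a_Suc by (rule order.trans)
  qed
  with le_omega_power[of ?\<epsilon>] have "?\<epsilon> = omega_power ?\<epsilon>" by (rule antisym)
  then have "\<epsilon>\<^sub>0 = omega_power \<epsilon>\<^sub>0"
    unfolding epsilon_0_def by (rule LeastI)
  then show ?thesis ..
qed

text \<open>
  Here the \<^emph>\<open>leastness\<close> of the fixed point \<open>\<epsilon>\<^sub>0\<close> enters. It yields both the descent of exponents in
  Cantor normal forms and the room needed above a finite set of ordinals.
\<close>

lemma less_omega_power_below_epsilon_0: "\<beta> < \<epsilon>\<^sub>0 \<Longrightarrow> \<beta> < omega_power \<beta>"
  using not_less_Least[of \<beta> "\<lambda>\<epsilon>. \<epsilon> = omega_power \<epsilon>"] le_omega_power[of \<beta>]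
  by (auto simp: epsilon_0_def)

lemma omega_power_less_epsilon_0: "\<beta> < \<epsilon>\<^sub>0 \<Longrightarrow> omega_power \<beta> < \<epsilon>\<^sub>0"
  using omega_power_strict_mono[of \<beta> \<epsilon>\<^sub>0] by (simp add: epsilon_0_fixed)

lemma epsilon_0_pos: "0 < \<epsilon>\<^sub>0"
  using omega_power_pos[of \<epsilon>\<^sub>0] by (simp add: epsilon_0_fixed)

lemma one_less_epsilon_0: "1 < \<epsilon>\<^sub>0"
  using omega_power_less_epsilon_0[OF epsilon_0_pos] by simp

section \<open>Cantor normal forms\<close>

definition Cantor_sum :: "(countable_ordinal \<times> nat) list \<Rightarrow> countable_ordinal"
  where "Cantor_sum ts = foldr (\<lambda>(\<beta>, n) \<xi>. omega_power \<beta> * finite_ordinal n + \<xi>) ts 0"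

lemma Cantor_sum_Nil [simp]: "Cantor_sum [] = 0"
  and Cantor_sum_Cons [simp]:
    "Cantor_sum ((\<beta>, n) # ts) = omega_power \<beta> * finite_ordinal n + Cantor_sum ts"
  by (simp_all add: Cantor_sum_def)

definition Cantor_list :: "(countable_ordinal \<times> nat) list \<Rightarrow> bool"
  where "Cantor_list ts \<longleftrightarrow> (\<forall>(\<beta>, n) \<in> set ts. n > 0) \<and> sorted_wrt (>) (map fst ts)"

lemma Cantor_list_Nil [simp]: "Cantor_list []"
  and Cantor_list_Cons [simp]: "Cantor_list ((\<beta>, n) # ts) \<longleftrightarrow>
    n > 0 \<and> (\<forall>\<gamma>\<in>fst ` set ts. \<gamma> < \<beta>) \<and> Cantor_list ts"
  by (auto simp: Cantor_list_def)

lemma is_Cantor_normal_form_iff: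
  "is_Cantor_normal_form \<alpha> ts \<longleftrightarrow>
    \<alpha> = Cantor_sum ts \<and> Cantor_list ts \<and> (\<forall>\<beta>\<in>fst ` set ts. \<beta> < \<alpha>)"
  by (auto simp: is_Cantor_normal_form_def Cantor_sum_def Cantor_list_def)

lemma omega_power_le_Cantor_sum:
  assumes "n > 0"
  shows "omega_power \<beta> \<le> Cantor_sum ((\<beta>, n) # ts)"
proof -
  have "omega_power \<beta> * 1 \<le> omega_power \<beta> * finite_ordinal n"
    using finite_ordinal_mono[of 1 n] assms by (intro ordinal_times_mono) simp
  then show ?thesis
    by (auto intro: order.trans ordinal_plus_ge)
qed

text \<open>
  A Cantor sum stays below the next multiple of its leading power. The leading term therefore
  decides the comparison of two Cantor sums, which gives uniqueness of the normal form.
\<close>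

lemma Cantor_sum_less:
  assumes "Cantor_list ts" "\<forall>\<gamma>\<in>fst ` set ts. \<gamma> < \<beta>"
  shows "Cantor_sum ts < omega_power \<beta>"
  using assms
proof (induction ts arbitrary: \<beta>)
  case Nil
  then show ?case by (simp add: omega_power_pos)
next
  case (Cons t ts)
  obtain \<gamma> n where t: "t = (\<gamma>, n)" by fastforce
  have "Cantor_sum ts < omega_power \<gamma>"
    using Cons t by auto
  then have "Cantor_sum (t # ts) < omega_power \<gamma> * finite_ordinal n + omega_power \<gamma>"
    unfolding t Cantor_sum_Cons by (rule ordinal_plus_strict_mono)
  also have "\<dots> \<le> omega_power \<beta>"
    using Cons.prems t by (intro omega_power_times_less) simp
  finally show ?case .
qed

lemma Cantor_sum_Cons_less:
  assumes "Cantor_list ((\<beta>, n) # ts)"  "n < m"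
  shows "Cantor_sum ((\<beta>, n) # ts) < Cantor_sum ((\<beta>, m) # us)"
proof -
  have "Cantor_sum ts < omega_power \<beta>"
    using assms by (intro Cantor_sum_less) auto
  then have "Cantor_sum ((\<beta>, n) # ts) < omega_power \<beta> * finite_ordinal (Suc n)"
    by (simp add: ordinal_times_plus_one ordinal_plus_less_iff)
  also have "\<dots> \<le> omega_power \<beta> * finite_ordinal m"
    using assms(2) by (intro ordinal_times_mono finite_ordinal_mono) simp
  also have "\<dots> \<le> Cantor_sum ((\<beta>, m) # us)"
    by (simp add: ordinal_plus_ge)
  finally show ?thesis .
qed

lemma Cantor_sum_inj:
  assumes "Cantor_list ts" "Cantor_list us" "Cantor_sum ts = Cantor_sum us"
  shows "ts = us"
  using assms
proof (induction ts arbitrary: us)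
  case Nil
  show ?case
  proof (cases us)
    case (Cons u us')
    obtain \<beta> n where "u = (\<beta>, n)" by fastforce
    then show ?thesis
      using omega_power_le_Cantor_sum[of n \<beta> us'] omega_power_pos[of \<beta>] Nil Cons by auto
  qed simp
next
  case (Cons t ts)
  obtain \<beta> n where t: "t = (\<beta>, n)" by fastforce
  have "us \<noteq> []"
    using omega_power_le_Cantor_sum[of n \<beta> ts] omega_power_pos[of \<beta>] Cons.prems t by auto
  then obtain \<gamma> m us' where us: "us = (\<gamma>, m) # us'"
    by (metis list.exhaust surj_pair)
  have lists: "Cantor_list ((\<beta>, n) # ts)" "Cantor_list ((\<gamma>, m) # us')"
    and sums: "Cantor_sum ((\<beta>, n) # ts) = Cantor_sum ((\<gamma>, m) # us')"
    using Cons.prems unfolding t us by blast+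
  have "\<beta> = \<gamma>"
  proof (rule ccontr)
    have *: False if "\<beta> < \<gamma>" "Cantor_list ((\<beta>, n) # ts)" "Cantor_list ((\<gamma>, m) # us)"
      "Cantor_sum ((\<beta>, n) # ts) = Cantor_sum ((\<gamma>, m) # us)" for \<beta> \<gamma> n m ts us
    proof -
      have "Cantor_sum ((\<beta>, n) # ts) < omega_power \<gamma>"
        using that by (intro Cantor_sum_less) auto
      also have "\<dots> \<le> Cantor_sum ((\<gamma>, m) # us)"
        using that by (intro omega_power_le_Cantor_sum) simp
      finally show ?thesis using that(4) by simp
    qed
    assume "\<beta> \<noteq> \<gamma>"
    then show False
      using *[OF _ lists sums] *[OF _ lists(2,1) sums[symmetric]] by (meson linorder_neqE)
  qed
  moreover have "n = m"
    using Cantor_sum_Cons_less[of \<beta> n ts m us'] Cantor_sum_Cons_less[of \<beta> m us' n ts]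
      lists sums \<open>\<beta> = \<gamma>\<close> by (metis linorder_neqE order_less_irrefl)
  ultimately have "Cantor_sum ts = Cantor_sum us'"
    using sums by (simp add: ordinal_plus_cancel)
  then show ?case
    using Cons.IH[of us'] lists \<open>\<beta> = \<gamma>\<close> \<open>n = m\<close> t us by simp
qed

lemma Cantor_normal_form_eqI:
  assumes "is_Cantor_normal_form \<alpha> ts"
  shows "Cantor_normal_form \<alpha> = ts"
proof -
  have "\<And>us. is_Cantor_normal_form \<alpha> us \<Longrightarrow> us = ts"
    using assms Cantor_sum_inj by (auto simp: is_Cantor_normal_form_iff)
  then have "\<exists>!us. is_Cantor_normal_form \<alpha> us" "(THE us. is_Cantor_normal_form \<alpha> us) = ts"
    using assms by blast+
  then show ?thesis by (simp add: Cantor_normal_form_def)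
qed

text \<open>
  Each of \<open>\<omega>^\<beta>\<close>, \<open>\<alpha> * \<beta>\<close> and \<open>\<alpha> + \<beta>\<close> is defined as a least upper bound, so an ordinal below it already lies below one of the bounded terms. Applying this
  to the three operations in turn produces \<open>\<gamma>\<close>, \<open>n\<close> and \<open>\<rho>\<close>.
\<close>

lemma ordinal_division_omega_power:
  assumes "0 < \<alpha>"
  obtains \<gamma> n \<rho> where "0 < n" "\<rho> < omega_power \<gamma>" "omega_power \<gamma> \<le> \<alpha>"
    "\<alpha> = omega_power \<gamma> * finite_ordinal n + \<rho>"
proof -
  have ex: "\<exists>\<beta>. \<alpha> < omega_power \<beta>"
    using le_omega_power[of "\<alpha> + 1"] ordinal_less_plus_one_iff[of \<alpha> \<alpha>]
    by (meson order.refl order.strict_trans2)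
  define \<beta> where "\<beta> = (LEAST \<beta>. \<alpha> < omega_power \<beta>)"
  have "\<alpha> < omega_power \<beta>" unfolding \<beta>_def by (rule LeastI_ex[OF ex])
  moreover have "1 \<le> \<alpha>" using assms ordinal_less_one_iff[of \<alpha>] by (meson not_le order_less_irrefl)
  ultimately obtain \<gamma> where \<gamma>: "\<gamma> < \<beta>" "\<alpha> < omega_power \<gamma> * \<omega>"
    using omega_power_least[of \<alpha> \<beta>] by (meson not_le)
  have le: "omega_power \<gamma> \<le> \<alpha>"
    using not_less_Least[OF \<gamma>(1)[unfolded \<beta>_def]] by simp
  let ?p = "omega_power \<gamma>"
  obtain \<delta> where "\<delta> < \<omega>" "\<alpha> < ?p * \<delta> + ?p"
    using \<gamma>(2) ordinal_times_least[of \<omega> ?p \<alpha>] by (meson not_le)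
  then have ex: "\<exists>n. \<alpha> < ?p * finite_ordinal n + ?p"
    using less_omega_finite by blast
  define n where "n = (LEAST n. \<alpha> < ?p * finite_ordinal n + ?p)"
  have n: "\<alpha> < ?p * finite_ordinal n + ?p"
    unfolding n_def by (rule LeastI_ex[OF ex])
  have "0 < n" using n le by (cases n) auto
  then obtain k where k: "n = Suc k" by (cases n) auto
  then have "\<not> \<alpha> < ?p * finite_ordinal k + ?p"
    using not_less_Least[of k "\<lambda>n. \<alpha> < ?p * finite_ordinal n + ?p"] by (simp add: n_def)
  then have n_le: "?p * finite_ordinal n \<le> \<alpha>"
    by (simp add: k ordinal_times_plus_one)
  have ex: "\<exists>\<rho>. \<rho> < ?p \<and> \<alpha> \<le> ?p * finite_ordinal n + \<rho>"
    using n n_le ordinal_plus_least[of "?p * finite_ordinal n" \<alpha> ?p] by (meson not_le)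
  define \<rho> where "\<rho> = (LEAST \<rho>. \<rho> < ?p \<and> \<alpha> \<le> ?p * finite_ordinal n + \<rho>)"
  have \<rho>: "\<rho> < ?p" "\<alpha> \<le> ?p * finite_ordinal n + \<rho>"
    using LeastI_ex[OF ex] unfolding \<rho>_def by auto
  have "?p * finite_ordinal n + \<rho> \<le> \<alpha>"
  proof (rule ordinal_plus_least[OF n_le])
    fix \<sigma> assume "\<sigma> < \<rho>"
    then show "?p * finite_ordinal n + \<sigma> < \<alpha>"
      using not_less_Least[of \<sigma> "\<lambda>\<rho>. \<rho> < ?p \<and> \<alpha> \<le> ?p * finite_ordinal n + \<rho>"] \<rho>(1)
      by (auto simp: \<rho>_def[symmetric] not_le)
  qed
  with \<rho>(2) have "\<alpha> = ?p * finite_ordinal n + \<rho>" by (rule antisym)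
  with that \<open>0 < n\<close> \<rho>(1) le show ?thesis by blast
qed

lemma Cantor_normal_form_exists:
  assumes "\<alpha> < \<epsilon>\<^sub>0"
  shows "\<exists>ts. is_Cantor_normal_form \<alpha> ts"
  using assms
proof (induction \<alpha> rule: less_induct)
  case (less \<alpha>)
  show ?case
  proof (cases "\<alpha> = 0")
    case True
    then have "is_Cantor_normal_form \<alpha> []" by (simp add: is_Cantor_normal_form_iff)
    then show ?thesis ..
  next
    case False
    then have "0 < \<alpha>" by (simp add: ordinal_pos_iff)
    from ordinal_division_omega_power[OF this] obtain \<gamma> n \<rho> where
      *: "0 < n" "\<rho> < omega_power \<gamma>" "omega_power \<gamma> \<le> \<alpha>"
         "\<alpha> = omega_power \<gamma> * finite_ordinal n + \<rho>" by blast
    have "\<rho> < \<alpha>" "\<rho> < \<epsilon>\<^sub>0" using * less.prems by auto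
    then obtain ts where ts: "is_Cantor_normal_form \<rho> ts" using less.IH by blast
    have "\<gamma> \<noteq> \<alpha>" "\<gamma> \<le> \<alpha>"
      using less_omega_power_below_epsilon_0[OF less.prems] *(3) le_omega_power[of \<gamma>] by auto
    then have "\<gamma> < \<alpha>" by simp
    have lt: "\<beta> < \<gamma>" if "\<beta> \<in> fst ` set ts" for \<beta>
    proof (cases ts)
      case (Cons t us)
      obtain \<beta>' m where t: "t = (\<beta>', m)" by fastforce
      have "\<beta> \<le> \<beta>'" "0 < m"
        using ts that t Cons by (auto simp: is_Cantor_normal_form_iff)
      moreover have "omega_power \<beta>' \<le> \<rho>"
        using ts omega_power_le_Cantor_sum[OF \<open>0 < m\<close>, of \<beta>' us]
        by (auto simp: is_Cantor_normal_form_iff t Cons)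
      ultimately show ?thesis
        using *(2) omega_power_less_iff[of \<beta>' \<gamma>] by auto
    qed (use that in simp)
    have "is_Cantor_normal_form \<alpha> ((\<gamma>, n) # ts)"
      using ts lt * \<open>\<gamma> < \<alpha>\<close> by (auto simp: is_Cantor_normal_form_iff)
    then show ?thesis ..
  qed
qed

section \<open>The functions \<open>\<mu>\<close> and \<open>\<delta>\<close>\<close>

text \<open>
  The existence of normal forms is needed here: without it \<^const>\<open>Cantor_normal_form\<close> could take
  its default value \<open>[]\<close>, and \<open>\<delta>\<close> would be \<open>0\<close>.
\<close>

lemma delta_pos:
  assumes "\<alpha> < \<epsilon>\<^sub>0"
  shows "0 < delta \<alpha>"
proof (cases "\<alpha> = 0")
  case False
  obtain ts where ts: "is_Cantor_normal_form \<alpha> ts"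
    using Cantor_normal_form_exists[OF assms] ..
  then obtain \<beta> n us where us: "ts = (\<beta>, n) # us" "0 < n"
    using False by (cases ts) (auto simp: is_Cantor_normal_form_iff)
  have "2 \<le> (delta \<beta> + 2) * n"
    using us(2) by (cases n) auto
  then show ?thesis
    using False us unfolding delta.simps[of \<alpha>] Cantor_normal_form_eqI[OF ts] by simp
qed (simp add: delta.simps[of 0])

lemma mu_commute: "mu \<alpha> \<beta> = mu \<beta> \<alpha>"
  by (simp add: mu_def max.commute)

lemma mu_zero_above: "\<beta> \<le> \<gamma> \<Longrightarrow> mu\<^sub>0 \<beta> \<gamma> = 0"
  using Cantor_normal_form_less[of \<gamma> _ \<beta>]
  by (force simp: mu\<^sub>0_def leD split: option.split dest!: map_of_SomeD)

text \<open>
  The extension property that drives the whole proof. The summand \<open>\<omega>^\<eta>\<close> lifts \<open>\<gamma>\<close> above \<open>T\<close>, so that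
  \<open>\<mu>\<^sub>0(\<beta>, \<gamma>) = 0\<close> for \<open>\<beta> \<in> T\<close>, without disturbing the coefficients of the \<open>\<omega>^\<beta>\<close>.
\<close>

lemma ordinal_with_prescribed_mu:
  assumes "finite T" "T \<subseteq> {..<\<epsilon>\<^sub>0}"
  obtains \<gamma> where "\<gamma> < \<epsilon>\<^sub>0" "\<gamma> \<notin> T" "\<And>\<beta>. \<beta> \<in> T \<Longrightarrow> mu \<gamma> \<beta> = k \<beta>"
proof -
  obtain \<eta> where \<eta>: "\<eta> < \<epsilon>\<^sub>0" "\<forall>\<beta>\<in>T. \<beta> < \<eta>"
  proof (cases "T = {}")
    case True
    then show ?thesis using that epsilon_0_pos by blast
  next
    case False
    then have "Max T < \<epsilon>\<^sub>0" using assms by auto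
    then have "omega_power (Max T) < \<epsilon>\<^sub>0" "Max T < omega_power (Max T)"
      by (rule omega_power_less_epsilon_0 less_omega_power_below_epsilon_0)+
    then show ?thesis using that assms(1) Max_ge order.strict_trans1 by blast
  qed
  define S where "S = {\<beta>\<in>T. 0 < k \<beta>}"
  have S: "finite S" "S \<subseteq> T" using assms(1) by (auto simp: S_def)
  define us where "us = map (\<lambda>\<beta>. (\<beta>, k \<beta>)) (rev (sorted_list_of_set S))"
  define ts where "ts = (\<eta>, 1) # us"
  define \<gamma> where "\<gamma> = Cantor_sum ts"
  have fst_us: "fst ` set us = S" using S(1) by (auto simp: us_def image_image)
  have "Cantor_list us"
    using S(1) by (auto simp: Cantor_list_def us_def S_def comp_def rev_map[symmetric] sorted_wrt_rev
        intro: strict_sorted_list_of_set)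
  then have list: "Cantor_list ts"
    using \<eta>(2) S(2) by (auto simp: ts_def fst_us)
  have "\<eta> < omega_power \<eta>" using \<eta>(1) by (rule less_omega_power_below_epsilon_0)
  also have "\<dots> \<le> \<gamma>" unfolding \<gamma>_def ts_def by (rule omega_power_le_Cantor_sum) simp
  finally have "\<eta> < \<gamma>" .
  have "fst ` set ts = insert \<eta> S" by (simp add: ts_def fst_us)
  then have "is_Cantor_normal_form \<gamma> ts"
    using list \<open>\<eta> < \<gamma>\<close> \<eta>(2) S(2) by (auto simp: is_Cantor_normal_form_iff \<gamma>_def intro: order.strict_trans)
  then have CNF: "Cantor_normal_form \<gamma> = ts" by (rule Cantor_normal_form_eqI)
  have "\<gamma> < omega_power \<epsilon>\<^sub>0"
    unfolding \<gamma>_def using list \<eta> S(2) by (intro Cantor_sum_less) (auto simp: ts_def fst_us)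
  then have "\<gamma> < \<epsilon>\<^sub>0" by (simp add: epsilon_0_fixed)
  moreover have "\<gamma> \<notin> T" using \<eta>(2) \<open>\<eta> < \<gamma>\<close> by auto
  moreover have "mu \<gamma> \<beta> = k \<beta>" if "\<beta> \<in> T" for \<beta>
  proof -
    have "map_of us = (Some \<circ> k) |` S"
      using S(1) by (simp add: us_def map_of_map_restrict)
    then have "mu\<^sub>0 \<gamma> \<beta> = k \<beta>"
      using that \<eta>(2) by (auto simp: mu\<^sub>0_def CNF ts_def S_def restrict_map_def)
    moreover have "mu\<^sub>0 \<beta> \<gamma> = 0"
      using that \<eta>(2) \<open>\<eta> < \<gamma>\<close> by (intro mu_zero_above) (meson order.strict_trans order_less_imp_le)
    ultimately show ?thesis by (simp add: mu_def)
  qed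
  ultimately show ?thesis using that by blast
qed

section \<open>Polynomials over the field with two elements\<close>

abbreviation lookup :: "('a \<Rightarrow>\<^sub>0 'b::zero) \<Rightarrow> 'a \<Rightarrow> 'b" where "lookup \<equiv> Poly_Mapping.lookup"
abbreviation keys :: "('a \<Rightarrow>\<^sub>0 'b::zero) \<Rightarrow> 'a set" where "keys \<equiv> Poly_Mapping.keys"
abbreviation single :: "'a \<Rightarrow> 'b::zero \<Rightarrow> 'a \<Rightarrow>\<^sub>0 'b" where "single \<equiv> Poly_Mapping.single"

definition restrict_keys :: "'a set \<Rightarrow> ('a \<Rightarrow>\<^sub>0 'b::zero) \<Rightarrow> ('a \<Rightarrow>\<^sub>0 'b)"
  where "restrict_keys S = Poly_Mapping.mapp (\<lambda>m c. c when m \<in> S)"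

lemma lookup_restrict_keys: "lookup (restrict_keys S p) m = (if m \<in> S then lookup p m else 0)"
  by (auto simp: restrict_keys_def lookup_mapp in_keys_iff when_def)

lemma keys_restrict_keys [simp]: "keys (restrict_keys S p) = keys p \<inter> S"
  by (auto simp: in_keys_iff lookup_restrict_keys split: if_splits)

lemma restrict_keys_add:
  "restrict_keys S (p + q) = restrict_keys S p + restrict_keys S (q :: 'a \<Rightarrow>\<^sub>0 'b::monoid_add)"
  by (rule poly_mapping_eqI) (simp add: lookup_restrict_keys lookup_add)

lemma poly_mapping_eq_sum_single:
  assumes "finite S" "keys p \<subseteq> S"
  shows "p = (\<Sum>m\<in>S. single m (lookup p m))"
  by (rule poly_mapping_eqI)
    (use assms in \<open>auto simp: lookup_sum lookup_single when_def in_keys_iff\<close>)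

text \<open>
  No cancellation can occur at an exponent that arises from the supports in a single way.
\<close>

lemma lookup_mult_unique:
  fixes p q :: "'a::monoid_add \<Rightarrow>\<^sub>0 'b::semiring_0"
  assumes "\<And>a b. a \<in> keys p \<Longrightarrow> b \<in> keys q \<Longrightarrow> a + b = a\<^sub>0 + b\<^sub>0 \<Longrightarrow> a = a\<^sub>0 \<and> b = b\<^sub>0"
  shows "lookup (p * q) (a\<^sub>0 + b\<^sub>0) = lookup p a\<^sub>0 * lookup q b\<^sub>0"
proof -
  define P Q where "P = insert a\<^sub>0 (keys p)" and "Q = insert b\<^sub>0 (keys q)"
  have fin: "finite P" "finite Q" and sub: "keys p \<subseteq> P" "keys q \<subseteq> Q"
    by (auto simp: P_def Q_def)
  have "lookup (p * q) (a\<^sub>0 + b\<^sub>0) =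
      lookup ((\<Sum>a\<in>P. single a (lookup p a)) * (\<Sum>b\<in>Q. single b (lookup q b))) (a\<^sub>0 + b\<^sub>0)"
    using poly_mapping_eq_sum_single[OF fin(1) sub(1)] poly_mapping_eq_sum_single[OF fin(2) sub(2)]
    by simp
  also have "\<dots> = (\<Sum>a\<in>P. \<Sum>b\<in>Q. lookup p a * lookup q b when a + b = a\<^sub>0 + b\<^sub>0)"
    by (simp add: sum_product lookup_sum mult_single lookup_single)
  also have "\<dots> = (\<Sum>a\<in>P. \<Sum>b\<in>Q. if b = b\<^sub>0 then (if a = a\<^sub>0 then lookup p a * lookup q b else 0) else 0)"
  proof (intro sum.cong refl)
    fix a b
    show "(lookup p a * lookup q b when a + b = a\<^sub>0 + b\<^sub>0) =
      (if b = b\<^sub>0 then (if a = a\<^sub>0 then lookup p a * lookup q b else 0) else 0)"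
      using assms[of a b]
      by (cases "lookup p a = 0"; cases "lookup q b = 0") (auto simp: when_def in_keys_iff)
  qed
  also have "\<dots> = lookup p a\<^sub>0 * lookup q b\<^sub>0"
    using fin by (simp add: P_def Q_def)
  finally show ?thesis .
qed

lemma lookup_monom: "lookup (monom n) m = (if m = n then 1 else 0)"
  by (auto simp: monom_def lookup_single when_def)

lemma keys_monom [simp]: "keys (monom n) = {n}"
  by (simp add: monom_def)

lemma var_eq_monom: "var \<alpha> = monom (single \<alpha> 1)"
  by (simp add: var_def)

lemma monom_mult: "monom m * monom n = monom (m + n)"
  by (simp add: monom_def mult_single)

lemma monom_zero [simp]: "monom 0 = 1"
  by (simp add: monom_def)

lemma monom_power: "monom (single \<alpha> 1) ^ k = monom (single \<alpha> k)"
  by (induction k) (simp_all add: monom_mult single_add[symmetric])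

lemma lookup_monom_mult [simp]: "lookup (monom n * p) (n + m) = lookup p m"
  by (subst lookup_mult_unique) (auto simp: lookup_monom)

lemma lookup_monom_mult_not_dvd:
  assumes "\<And>k. m \<noteq> n + k"
  shows "lookup (monom n * p) m = 0"
proof -
  have "m \<notin> keys (monom n * p)"
    using keys_mult[of "monom n" p] assms by fastforce
  then show ?thesis by (simp add: in_keys_iff)
qed

lemma poly_eq_sum_monom: "p = (\<Sum>m\<in>keys p. monom m)" for p :: polynomial
proof -
  have "single m (lookup p m) = monom m" if "m \<in> keys p" for m
    using that by (simp add: monom_def in_keys_iff)
  then show ?thesis
    using poly_mapping_eq_sum_single[of "keys p" p] by simp
qed

lemma double_poly [simp]: "p + p = 0" for p :: polynomial
proof (rule poly_mapping_eqI)
  fix m show "lookup (p + p) m = lookup 0 m"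
    unfolding lookup_add by simp
qed

lemma exponents_add_zero_iff [simp]: "m + n = 0 \<longleftrightarrow> m = 0 \<and> n = (0 :: exponents)"
proof
  assume *: "m + n = 0"
  have "lookup m \<alpha> = 0 \<and> lookup n \<alpha> = 0" for \<alpha>
    using arg_cong[OF *, of "\<lambda>m. lookup m \<alpha>"] by (simp add: lookup_add)
  then show "m = 0 \<and> n = 0" by (simp add: poly_mapping_eq_iff fun_eq_iff)
qed simp

lemma exponents_le_imp_add:
  fixes m n :: exponents
  assumes "\<And>\<alpha>. lookup n \<alpha> \<le> lookup m \<alpha>"
  shows "m = n + (m - n)"
  using assms by (simp add: poly_mapping_eq_iff fun_eq_iff lookup_add lookup_minus)

section \<open>The polynomial ring\<close>

lemma zero_eps0_exponents [simp]: "0 \<in> eps0_exponents"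
  by (simp add: eps0_exponents_def)

lemma eps0_exponents_add [simp]: "m + n \<in> eps0_exponents \<longleftrightarrow> m \<in> eps0_exponents \<and> n \<in> eps0_exponents"
  by (auto simp: eps0_exponents_def subset_iff in_keys_iff lookup_add)

lemma single_eps0_exponents [simp]: "\<alpha> < \<epsilon>\<^sub>0 \<Longrightarrow> single \<alpha> k \<in> eps0_exponents"
  by (auto simp: eps0_exponents_def)

abbreviation eps0_polys :: "polynomial set"
  where "eps0_polys \<equiv> carrier poly_ring"

lemma eps0_polys_iff: "p \<in> eps0_polys \<longleftrightarrow> keys p \<subseteq> eps0_exponents"
  by (simp add: poly_ring_def)

lemma poly_ring_simps [simp]:
  "mult poly_ring = (*)" "one poly_ring = 1" "zero poly_ring = 0" "add poly_ring = (+)"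
  by (simp_all add: poly_ring_def)

lemma eps0_polys_closed [simp]:
  "0 \<in> eps0_polys" "1 \<in> eps0_polys"
  "p \<in> eps0_polys \<Longrightarrow> q \<in> eps0_polys \<Longrightarrow> p + q \<in> eps0_polys"
  "p \<in> eps0_polys \<Longrightarrow> q \<in> eps0_polys \<Longrightarrow> p * q \<in> eps0_polys"
  "m \<in> eps0_exponents \<Longrightarrow> monom m \<in> eps0_polys"
  "p \<in> eps0_polys \<Longrightarrow> restrict_keys S p \<in> eps0_polys"
  using keys_add[of p q] keys_mult[of p q] by (force simp: eps0_polys_iff)+

lemma cring_poly_ring: "cring poly_ring"
proof (rule cringI)
  show "abelian_group poly_ring"
  proof (rule abelian_groupI)
    fix p assume "p \<in> eps0_polys"
    then show "\<exists>q\<in>eps0_polys. q \<oplus>\<^bsub>poly_ring\<^esub> p = \<zero>\<^bsub>poly_ring\<^esub>"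
      by (intro bexI[of _ p]) simp_all
  qed (auto simp: add_ac)
  show "comm_monoid poly_ring"
    by (rule comm_monoidI) (auto simp: mult_ac)
qed (auto simp: algebra_simps)

interpretation poly_ring: cring poly_ring
  by (rule cring_poly_ring)

lemma poly_ring_minus: "p \<in> eps0_polys \<Longrightarrow> q \<in> eps0_polys \<Longrightarrow> p \<ominus>\<^bsub>poly_ring\<^esub> q = p + q"
proof -
  assume "q \<in> eps0_polys"
  then have "\<ominus>\<^bsub>poly_ring\<^esub> q = q"
    by (intro poly_ring.minus_equality) auto
  then show ?thesis by (simp add: a_minus_def)
qed

lemma eps0_polys_sum: "(\<And>i. i \<in> I \<Longrightarrow> f i \<in> eps0_polys) \<Longrightarrow> sum f I \<in> eps0_polys"
  by (induction I rule: infinite_finite_induct) auto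

lemma poly_ideal_sum:
  assumes "ideal K poly_ring" "\<And>i. i \<in> I \<Longrightarrow> f i \<in> K"
  shows "sum f I \<in> K"
proof -
  interpret ideal K poly_ring by fact
  show ?thesis using assms(2)
    by (induction I rule: infinite_finite_induct) (use a_closed zero_closed in auto)
qed

lemma ideal_supported:
  fixes S :: "exponents set"
  assumes "S \<subseteq> eps0_exponents" "\<And>s k. s \<in> S \<Longrightarrow> k \<in> eps0_exponents \<Longrightarrow> s + k \<in> S"
  shows "ideal {p :: polynomial. keys p \<subseteq> S} poly_ring"
proof (rule idealI[OF poly_ring.ring_axioms])
  show "subgroup {p. keys p \<subseteq> S} (add_monoid poly_ring)"
  proof
    show "{p. keys p \<subseteq> S} \<subseteq> carrier (add_monoid poly_ring)"
      using assms(1) by (auto simp: eps0_polys_iff)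
    fix p q :: polynomial assume pq: "p \<in> {p. keys p \<subseteq> S}" "q \<in> {p. keys p \<subseteq> S}"
    then show "p \<otimes>\<^bsub>add_monoid poly_ring\<^esub> q \<in> {p. keys p \<subseteq> S}"
      using keys_add[of p q] by auto
    have "p \<in> eps0_polys" using pq assms(1) by (auto simp: eps0_polys_iff)
    then have "inv\<^bsub>add_monoid poly_ring\<^esub> p = p"
      using poly_ring.minus_equality[of p p] by (simp add: a_inv_def)
    then show "inv\<^bsub>add_monoid poly_ring\<^esub> p \<in> {p. keys p \<subseteq> S}" using pq by simp
  qed simp
  fix p q :: polynomial assume pq: "p \<in> {p. keys p \<subseteq> S}" "q \<in> eps0_polys"
  then have "keys (p * q) \<subseteq> S"
    using keys_mult[of p q] assms(2) by (fastforce simp: eps0_polys_iff)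
  then show "p \<otimes>\<^bsub>poly_ring\<^esub> q \<in> {p. keys p \<subseteq> S}" "q \<otimes>\<^bsub>poly_ring\<^esub> p \<in> {p. keys p \<subseteq> S}"
    by (simp_all add: mult.commute)
qed

definition multiples :: "exponents set \<Rightarrow> exponents set"
  where "multiples M = {n + k | n k. n \<in> M \<and> k \<in> eps0_exponents}"

lemma multiples_subset: "M \<subseteq> eps0_exponents \<Longrightarrow> multiples M \<subseteq> eps0_exponents"
  by (auto simp: multiples_def)

text \<open>
  Over the field with two elements a polynomial is the sum of the monomials in its support, so
  membership in a monomial ideal is a condition on the support.
\<close>

lemma genideal_monomials:
  assumes "M \<subseteq> eps0_exponents"
  shows "genideal poly_ring (monom ` M) = {p. keys p \<subseteq> multiples M}"
proof
  have sub: "monom ` M \<subseteq> eps0_polys" using assms by auto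
  have "ideal {p. keys p \<subseteq> multiples M} poly_ring"
  proof (rule ideal_supported[OF multiples_subset[OF assms]])
    fix s k assume "s \<in> multiples M" and k: "k \<in> eps0_exponents"
    then obtain n l where "s = n + l" "n \<in> M" "l \<in> eps0_exponents" by (auto simp: multiples_def)
    then have "s + k = n + (l + k)" "l + k \<in> eps0_exponents"
      using k by (simp_all add: add.assoc)
    then show "s + k \<in> multiples M"
      unfolding multiples_def using \<open>n \<in> M\<close> by blast
  qed
  moreover have "monom ` M \<subseteq> {p. keys p \<subseteq> multiples M}"
  proof safe
    fix n assume "n \<in> M"
    then have "n + 0 \<in> multiples M"
      unfolding multiples_def using zero_eps0_exponents by blast
    then show "\<And>m. m \<in> keys (monom n) \<Longrightarrow> m \<in> multiples M" by simp
  qed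
  ultimately show "genideal poly_ring (monom ` M) \<subseteq> {p. keys p \<subseteq> multiples M}"
    by (rule poly_ring.genideal_minimal)
  interpret G: ideal "genideal poly_ring (monom ` M)" poly_ring
    by (rule poly_ring.genideal_ideal[OF sub])
  have "monom m \<in> genideal poly_ring (monom ` M)" if "m \<in> multiples M" for m
  proof -
    obtain n k where nk: "m = n + k" "n \<in> M" "k \<in> eps0_exponents"
      using \<open>m \<in> multiples M\<close> by (auto simp: multiples_def)
    then have "monom n \<in> genideal poly_ring (monom ` M)"
      using poly_ring.genideal_self[OF sub] by auto
    from G.I_r_closed[OF this, of "monom k"] nk show ?thesis by (simp add: monom_mult)
  qed
  then show "{p. keys p \<subseteq> multiples M} \<subseteq> genideal poly_ring (monom ` M)"
    using poly_eq_sum_monom poly_ideal_sum[OF G.ideal_axioms] by (metis (no_types, lifting) mem_Collect_eq subset_iff)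
qed

section \<open>The monomial basis of the \<open>\<epsilon>\<^sub>0\<close>-algebra\<close>

text \<open>
  The monomials in the ideal of relations, and those in the ideal generated by all products
  \<open>x\<^sub>\<alpha> x\<^sub>\<beta>\<close> with \<open>\<alpha> \<noteq> \<beta>\<close> (\<open>mixed\<close> below). The complement of \<open>vanishing\<close> indexes a basis of the
  \<open>\<epsilon>\<^sub>0\<close>-algebra.
\<close>

definition vanishing :: "exponents set"
  where "vanishing = {m \<in> eps0_exponents.
    \<exists>\<alpha> \<beta>. \<alpha> \<noteq> \<beta> \<and> 1 \<le> lookup m \<alpha> \<and> 1 + mu \<alpha> \<beta> \<le> lookup m \<beta>}"

abbreviation standard :: "exponents set"
  where "standard \<equiv> eps0_exponents - vanishing"

definition mixed :: "exponents set"
  where "mixed = {m \<in> eps0_exponents. \<exists>\<alpha> \<beta>. \<alpha> \<noteq> \<beta> \<and> 1 \<le> lookup m \<alpha> \<and> 1 \<le> lookup m \<beta>}"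

text \<open>
  The case \<open>h = \<mu>\<close> describes the relations of the \<open>\<epsilon>\<^sub>0\<close>-algebra, the case \<open>h = 0\<close> those of its
  reduced quotient.
\<close>

lemma multiples_of_two_variables:
  "multiples {single \<alpha> 1 + single \<beta> (1 + h \<alpha> \<beta>) | \<alpha> \<beta>. \<alpha> < \<epsilon>\<^sub>0 \<and> \<beta> < \<epsilon>\<^sub>0 \<and> \<alpha> \<noteq> \<beta>} =
    {m \<in> eps0_exponents. \<exists>\<alpha> \<beta>. \<alpha> \<noteq> \<beta> \<and> 1 \<le> lookup m \<alpha> \<and> 1 + h \<alpha> \<beta> \<le> lookup m \<beta>}" (is "multiples ?M = ?S")
proof
  show "multiples ?M \<subseteq> ?S"
  proof
    fix m assume "m \<in> multiples ?M"
    then obtain \<alpha> \<beta> k where *: "m = single \<alpha> 1 + single \<beta> (1 + h \<alpha> \<beta>) + k" "k \<in> eps0_exponents"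
      "\<alpha> < \<epsilon>\<^sub>0" "\<beta> < \<epsilon>\<^sub>0" "\<alpha> \<noteq> \<beta>" by (auto simp: multiples_def)
    then have "1 \<le> lookup m \<alpha>" "1 + h \<alpha> \<beta> \<le> lookup m \<beta>" "m \<in> eps0_exponents"
      by (simp_all add: lookup_add)
    then show "m \<in> ?S" using *(5) by blast
  qed
  show "?S \<subseteq> multiples ?M"
  proof
    fix m assume "m \<in> ?S"
    then obtain \<alpha> \<beta> where *: "m \<in> eps0_exponents" "\<alpha> \<noteq> \<beta>" "1 \<le> lookup m \<alpha>" "1 + h \<alpha> \<beta> \<le> lookup m \<beta>"
      by blast
    let ?n = "single \<alpha> 1 + single \<beta> (1 + h \<alpha> \<beta>)"
    have m: "m = ?n + (m - ?n)"
      using * by (intro exponents_le_imp_add) (auto simp: lookup_add lookup_single when_def)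
    then have "m - ?n \<in> eps0_exponents"
      using *(1) by (metis eps0_exponents_add)
    moreover have "\<alpha> \<in> keys m" "\<beta> \<in> keys m" using * by (auto simp: in_keys_iff)
    then have "\<alpha> < \<epsilon>\<^sub>0" "\<beta> < \<epsilon>\<^sub>0" using *(1) by (auto simp: eps0_exponents_def)
    ultimately show "m \<in> multiples ?M"
      using m *(2) unfolding multiples_def by blast
  qed
qed

lemma eps0_ideal_eq: "eps0_ideal = {p. keys p \<subseteq> vanishing}"
proof -
  let ?M = "{single \<alpha> 1 + single \<beta> (1 + mu \<alpha> \<beta>) | \<alpha> \<beta>. \<alpha> < \<epsilon>\<^sub>0 \<and> \<beta> < \<epsilon>\<^sub>0 \<and> \<alpha> \<noteq> \<beta>}"
  have "var \<alpha> * var \<beta> ^ k = monom (single \<alpha> 1 + single \<beta> k)" for \<alpha> \<beta> k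
    by (simp add: var_def monom_power[simplified] monom_mult)
  then have "eps0_relations = monom ` ?M"
    unfolding eps0_relations_def by (auto simp only: image_iff mem_Collect_eq)
  moreover have "?M \<subseteq> eps0_exponents" by auto
  ultimately show ?thesis
    unfolding eps0_ideal_def using multiples_of_two_variables[of mu] genideal_monomials[of ?M]
    by (simp add: vanishing_def)
qed

lemma reduced_ideal_eq: "reduced_ideal = {p. keys p \<subseteq> mixed}"
proof -
  let ?M = "{single \<alpha> 1 + single \<beta> (1 + 0) | \<alpha> \<beta>. \<alpha> < \<epsilon>\<^sub>0 \<and> \<beta> < \<epsilon>\<^sub>0 \<and> \<alpha> \<noteq> \<beta>} :: exponents set"
  have "var \<alpha> * var \<beta> = monom (single \<alpha> 1 + single \<beta> (1 + 0))" for \<alpha> \<beta>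
    by (simp add: var_def monom_mult)
  then have "{var \<alpha> * var \<beta> | \<alpha> \<beta>. \<alpha> < \<epsilon>\<^sub>0 \<and> \<beta> < \<epsilon>\<^sub>0 \<and> \<alpha> \<noteq> \<beta>} = monom ` ?M"
    by (auto simp: image_iff)
  moreover have "?M \<subseteq> eps0_exponents" by auto
  ultimately show ?thesis
    unfolding reduced_ideal_def using multiples_of_two_variables[of "\<lambda>_ _. 0"] genideal_monomials[of ?M]
    by (simp add: mixed_def)
qed

lemma vanishing_add:
  assumes "m \<in> vanishing" "k \<in> eps0_exponents"
  shows "m + k \<in> vanishing"
  using assms unfolding vanishing_def by (auto simp: lookup_add intro: trans_le_add1)

lemma mixed_add: "m \<in> mixed \<Longrightarrow> k \<in> eps0_exponents \<Longrightarrow> m + k \<in> mixed"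
  unfolding mixed_def by (auto simp: lookup_add intro: trans_le_add1)

lemma vanishing_subset_mixed: "vanishing \<subseteq> mixed"
proof
  fix m assume "m \<in> vanishing"
  then obtain \<alpha> \<beta> where "m \<in> eps0_exponents" "\<alpha> \<noteq> \<beta>" "1 \<le> lookup m \<alpha>" "1 + mu \<alpha> \<beta> \<le> lookup m \<beta>"
    by (auto simp: vanishing_def)
  then have "1 \<le> lookup m \<beta>" by simp
  then show "m \<in> mixed" unfolding mixed_def
    using \<open>m \<in> eps0_exponents\<close> \<open>\<alpha> \<noteq> \<beta>\<close> \<open>1 \<le> lookup m \<alpha>\<close> by blast
qed

lemma pure_power_standard: 
  assumes "\<alpha> < \<epsilon>\<^sub>0"
  shows "single \<alpha> k \<in> standard"
  using assms by (auto simp: vanishing_def lookup_single when_def)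

lemma zero_standard [simp]: "0 \<in> standard"
  by (auto simp: vanishing_def)

lemma zero_not_vanishing [simp]: "0 \<notin> vanishing"
  using zero_standard by blast

lemma ideal_eps0_ideal: "ideal eps0_ideal poly_ring"
  unfolding eps0_ideal_eq by (rule ideal_supported) (auto simp: vanishing_add, simp add: vanishing_def)

lemma ideal_reduced_ideal: "ideal reduced_ideal poly_ring"
  unfolding reduced_ideal_eq by (rule ideal_supported) (auto simp: mixed_add, simp add: mixed_def)

abbreviation cls :: "polynomial \<Rightarrow> polynomial set"
  where "cls p \<equiv> eps0_ideal +>\<^bsub>poly_ring\<^esub> p"

interpretation eps0_algebra: cring eps0_algebra
  unfolding eps0_algebra_def by (rule ideal.quotient_is_cring[OF ideal_eps0_ideal poly_ring.is_cring])

lemma carrier_eps0_algebra: "carrier eps0_algebra = cls ` eps0_polys"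
  by (auto simp: eps0_algebra_def FactRing_def A_RCOSETS_def')

lemma
  assumes "p \<in> eps0_polys" "q \<in> eps0_polys"
  shows cls_add: "cls p \<oplus>\<^bsub>eps0_algebra\<^esub> cls q = cls (p + q)"
    and cls_mult: "cls p \<otimes>\<^bsub>eps0_algebra\<^esub> cls q = cls (p * q)"
  using ring_hom_add[OF ideal.rcos_ring_hom[OF ideal_eps0_ideal] assms] ring_hom_mult[OF ideal.rcos_ring_hom[OF ideal_eps0_ideal] assms]
  by (simp_all add: eps0_algebra_def)

lemma cls_one: "\<one>\<^bsub>eps0_algebra\<^esub> = cls 1"
  using ring_hom_one[OF ideal.rcos_ring_hom[OF ideal_eps0_ideal]] by (simp add: eps0_algebra_def)

lemma cls_zero: "\<zero>\<^bsub>eps0_algebra\<^esub> = cls 0"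
  using poly_ring.a_rcos_zero[OF ideal_eps0_ideal] by (simp add: eps0_algebra_def FactRing_def eps0_ideal_eq)

lemma cls_closed [simp]: "p \<in> eps0_polys \<Longrightarrow> cls p \<in> carrier eps0_algebra"
  by (simp add: carrier_eps0_algebra)

lemma cls_eq_iff:
  assumes "p \<in> eps0_polys" "q \<in> eps0_polys"
  shows "cls p = cls q \<longleftrightarrow> (\<forall>m\<in>standard. lookup p m = lookup q m)"
proof -
  have "cls p = cls q \<longleftrightarrow> p + q \<in> eps0_ideal"
    using poly_ring.quotient_eq_iff_same_a_r_cos[OF ideal_eps0_ideal assms] poly_ring_minus[OF assms]
    by simp
  also have "\<dots> \<longleftrightarrow> (\<forall>m. m \<notin> vanishing \<longrightarrow> lookup (p + q) m = 0)"
    by (auto simp: eps0_ideal_eq in_keys_iff)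
  also have "\<dots> \<longleftrightarrow> (\<forall>m\<in>standard. lookup (p + q) m = 0)"
    using assms by (auto simp: eps0_polys_iff subset_iff in_keys_iff lookup_add) 
  also have "\<dots> \<longleftrightarrow> (\<forall>m\<in>standard. lookup p m = lookup q m)"
  proof -
    have "a + b = 0 \<longleftrightarrow> a = b" for a b :: bit by (cases a; cases b) simp_all
    then show ?thesis by (simp only: lookup_add)
  qed
  finally show ?thesis .
qed

lemma cls_eq_zero_iff:
  assumes "p \<in> eps0_polys"
  shows "cls p = \<zero>\<^bsub>eps0_algebra\<^esub> \<longleftrightarrow> keys p \<subseteq> vanishing"
  using assms unfolding cls_zero cls_eq_iff[OF assms eps0_polys_closed(1)]
  by (auto simp: in_keys_iff eps0_polys_iff)

text \<open>
  The unique representative of a class that is a sum of standard monomials.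
\<close>

definition normal_form :: "polynomial set \<Rightarrow> polynomial"
  where "normal_form X = restrict_keys standard (SOME p. p \<in> eps0_polys \<and> X = cls p)"

lemma lookup_normal_form_cls:
  assumes "p \<in> eps0_polys"
  shows "lookup (normal_form (cls p)) m = (if m \<in> standard then lookup p m else 0)"
proof -
  let ?q = "SOME q. q \<in> eps0_polys \<and> cls p = cls q"
  have q: "?q \<in> eps0_polys" "cls p = cls ?q"
    using someI[of "\<lambda>q. q \<in> eps0_polys \<and> cls p = cls q" p] assms by auto
  with cls_eq_iff[OF assms q(1)] show ?thesis
    by (auto simp: normal_form_def lookup_restrict_keys)
qed

lemma keys_normal_form: "keys (normal_form X) \<subseteq> standard"
  by (auto simp: normal_form_def)

lemma normal_form_eps0_polys [simp]:
  assumes "X \<in> carrier eps0_algebra"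
  shows "normal_form X \<in> eps0_polys"
  using assms by (auto simp: carrier_eps0_algebra eps0_polys_iff in_keys_iff lookup_normal_form_cls split: if_splits)

lemma cls_normal_form [simp]:
  assumes "X \<in> carrier eps0_algebra"
  shows "cls (normal_form X) = X"
proof -
  obtain p where p: "p \<in> eps0_polys" "X = cls p" using assms by (auto simp: carrier_eps0_algebra)
  have "normal_form X \<in> eps0_polys" using assms by simp
  then show ?thesis
    unfolding p(2) using p by (simp add: cls_eq_iff lookup_normal_form_cls)
qed

lemma finsum_cls:
  assumes "\<And>i. i \<in> I \<Longrightarrow> f i \<in> eps0_polys" "finite I"
  shows "finsum eps0_algebra (\<lambda>i. cls (f i)) I = cls (sum f I)"
  using assms(2,1)
  by (induction I rule: finite_induct)
    (auto simp: cls_zero eps0_algebra.finsum_insert cls_add eps0_polys_sum Pi_def)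

text \<open>
  Ideals correspond under the quotient map, so a generated ideal may be computed with
  polynomials.
\<close>

lemma genideal_cls:
  assumes "S \<subseteq> eps0_polys"
  shows "genideal eps0_algebra (cls ` S) = cls ` genideal poly_ring S"
proof
  let ?G = "genideal poly_ring S" and ?H = "genideal eps0_algebra (cls ` S)"
  have G: "ideal ?G poly_ring" by (rule poly_ring.genideal_ideal[OF assms])
  have sub: "cls ` S \<subseteq> carrier eps0_algebra" using assms by auto
  show "?H \<subseteq> cls ` ?G"
    using poly_ring.ring_ideal_imp_quot_ideal[OF ideal_eps0_ideal G] poly_ring.genideal_self[OF assms]
    by (intro eps0_algebra.genideal_minimal) (auto simp: eps0_algebra_def)
  have "ideal {p \<in> eps0_polys. cls p \<in> ?H} poly_ring"
    using ring_hom_ring.ideal_vimage[OF ideal.rcos_ring_hom_ring[OF ideal_eps0_ideal]]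
      eps0_algebra.genideal_ideal[OF sub] by (simp add: eps0_algebra_def)
  moreover have "S \<subseteq> {p \<in> eps0_polys. cls p \<in> ?H}"
    using assms eps0_algebra.genideal_self[OF sub] by auto
  ultimately have "?G \<subseteq> {p \<in> eps0_polys. cls p \<in> ?H}"
    by (rule poly_ring.genideal_minimal)
  then show "cls ` ?G \<subseteq> ?H" by auto
qed

section \<open>Double annihilators of monomial ideals\<close>

lemma genideal_eps0_monomials:
  assumes "M \<subseteq> eps0_exponents"
  shows "genideal eps0_algebra (cls ` monom ` M) = cls ` {p. keys p \<subseteq> multiples M}"
proof -
  have "monom ` M \<subseteq> eps0_polys" using assms by auto
  then show ?thesis using genideal_cls genideal_monomials[OF assms] by metis
qed

lemma subset_double_annihilator:
  assumes "cring R" "J \<subseteq> carrier R"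
  shows "J \<subseteq> annihilator R (annihilator R J)"
proof -
  interpret cring R by fact
  show ?thesis
    using assms(2) by (fastforce simp: annihilator_def m_comm)
qed

text \<open>
  With \<open>\<mu>(\<gamma>, \<beta>)\<close> equal to the exponent of \<open>x\<^sub>\<beta>\<close> in \<open>m\<close>, the variable \<open>x\<^sub>\<gamma>\<close> tolerates exactly the
  exponents that occur in \<open>m\<close>: it multiplies \<open>m\<close> to a nonzero monomial and kills every monomial
  in the variables from \<open>T\<close> that does not divide \<open>m\<close>.
\<close>

lemma separating_variable:
  assumes "m \<in> standard" "finite T" "T \<subseteq> {..<\<epsilon>\<^sub>0}" "keys m \<subseteq> T"
  obtains \<gamma> where "\<gamma> < \<epsilon>\<^sub>0" "\<gamma> \<notin> T" "single \<gamma> 1 + m \<in> standard"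
    "\<And>n. n \<in> eps0_exponents \<Longrightarrow> keys n \<subseteq> T \<Longrightarrow> \<not> (\<forall>\<beta>. lookup n \<beta> \<le> lookup m \<beta>) \<Longrightarrow>
      single \<gamma> 1 + n \<in> vanishing"
proof -
  obtain \<gamma> where \<gamma>: "\<gamma> < \<epsilon>\<^sub>0" "\<gamma> \<notin> T" "\<And>\<beta>. \<beta> \<in> T \<Longrightarrow> mu \<gamma> \<beta> = lookup m \<beta>"
    using ordinal_with_prescribed_mu[OF assms(2,3)] by blast
  have outside: "lookup m \<gamma> = 0" "\<And>\<beta>. \<beta> \<notin> T \<Longrightarrow> lookup m \<beta> = 0"
    using assms(4) \<gamma>(2) by (auto simp: in_keys_iff subset_iff)
  have lookup_\<gamma>: "lookup (single \<gamma> 1 + n) \<beta> = lookup n \<beta>" if "\<beta> \<noteq> \<gamma>" for n and \<beta>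
    using that by (simp add: lookup_add lookup_single)
  have "single \<gamma> 1 + m \<notin> vanishing"
  proof
    assume "single \<gamma> 1 + m \<in> vanishing"
    then obtain \<alpha> \<beta> where *: "\<alpha> \<noteq> \<beta>" "1 \<le> lookup (single \<gamma> 1 + m) \<alpha>"
      "1 + mu \<alpha> \<beta> \<le> lookup (single \<gamma> 1 + m) \<beta>" by (auto simp: vanishing_def)
    consider "\<alpha> = \<gamma>" | "\<beta> = \<gamma>" | "\<alpha> \<noteq> \<gamma>" "\<beta> \<noteq> \<gamma>" by blast
    then show False
    proof cases
      case 1
      then have "1 + mu \<gamma> \<beta> \<le> lookup m \<beta>" using * lookup_\<gamma> by metis
      then show False using \<gamma>(3)[of \<beta>] outside(2)[of \<beta>] by (cases "\<beta> \<in> T") auto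
    next
      case 2
      then have "1 \<le> lookup m \<alpha>" "mu \<alpha> \<gamma> = 0"
        using * lookup_\<gamma>[of \<alpha> m] outside(1) by (auto simp: lookup_add)
      then show False using \<gamma>(3)[of \<alpha>] outside(2)[of \<alpha>] mu_commute[of \<alpha> \<gamma>] by (cases "\<alpha> \<in> T") auto
    next
      case 3
      then have "1 \<le> lookup m \<alpha>" "1 + mu \<alpha> \<beta> \<le> lookup m \<beta>" 
        using *(2,3) unfolding lookup_\<gamma>[OF 3(1)] lookup_\<gamma>[OF 3(2)] by blast+
      then have "m \<in> vanishing" using *(1) assms(1) unfolding vanishing_def by blast
      then show False using assms(1) by blast
    qed
  qed
  then have "single \<gamma> 1 + m \<in> standard" using assms(1) \<gamma>(1) by auto
  moreover have "single \<gamma> 1 + n \<in> vanishing"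
    if n: "n \<in> eps0_exponents" "keys n \<subseteq> T" "\<not> (\<forall>\<beta>. lookup n \<beta> \<le> lookup m \<beta>)" for n
  proof -
    obtain \<beta> where \<beta>: "lookup m \<beta> < lookup n \<beta>" using n(3) by (auto simp: not_le)
    then have "\<beta> \<in> keys n" by (auto simp: in_keys_iff)
    then have "\<beta> \<in> T" using n(2) by blast
    then have "\<gamma> \<noteq> \<beta>" using \<gamma>(2) by blast
    then have "1 + mu \<gamma> \<beta> \<le> lookup (single \<gamma> 1 + n) \<beta>"
      unfolding lookup_\<gamma>[OF \<open>\<gamma> \<noteq> \<beta>\<close>[symmetric]] using \<beta> \<gamma>(3)[OF \<open>\<beta> \<in> T\<close>] by simp
    moreover have "1 \<le> lookup (single \<gamma> 1 + n) \<gamma>" by (simp add: lookup_add)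
    ultimately show ?thesis unfolding vanishing_def using \<open>\<gamma> \<noteq> \<beta>\<close> n(1) \<gamma>(1) by auto
  qed
  ultimately show ?thesis using that \<gamma>(1,2) by blast
qed

theorem monomial_double_annihilator:
  assumes "finite S" "S \<subseteq> eps0_monomials"
  shows "genideal eps0_algebra S =
    annihilator eps0_algebra (annihilator eps0_algebra (genideal eps0_algebra S))"
proof -
  have "S \<subseteq> (\<lambda>m. cls (monom m)) ` eps0_exponents"
    using assms(2) by (auto simp: eps0_monomials_def)
  then obtain M where M: "M \<subseteq> eps0_exponents" "finite M" "S = (\<lambda>m. cls (monom m)) ` M"
    using finite_subset_image[OF assms(1)] by blast
  define J where "J = genideal eps0_algebra S"
  have J: "J = cls ` {p. keys p \<subseteq> multiples M}"
    using genideal_eps0_monomials[OF M(1)] M(3) by (simp add: J_def image_image)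
  have polys: "{p. keys p \<subseteq> multiples M} \<subseteq> eps0_polys"
    using multiples_subset[OF M(1)] by (auto simp: eps0_polys_iff)
  have "annihilator eps0_algebra (annihilator eps0_algebra J) \<subseteq> J"
  proof
    fix X assume X: "X \<in> annihilator eps0_algebra (annihilator eps0_algebra J)"
    define p where "p = normal_form X"
    have carrier: "X \<in> carrier eps0_algebra" using X by (simp add: annihilator_def)
    then have p: "p \<in> eps0_polys" "X = cls p" by (simp_all add: p_def)
    have "m \<in> multiples M" if m: "m \<in> keys p" for m
    proof (rule ccontr)
      assume not: "m \<notin> multiples M"
      have "m \<in> standard"
        using m keys_normal_form by (auto simp: p_def)
      define T where "T = \<Union> (keys ` insert m M)"
      have T: "finite T" "T \<subseteq> {..<\<epsilon>\<^sub>0}" "keys m \<subseteq> T"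
        using M(1,2) \<open>m \<in> standard\<close> by (auto simp: T_def eps0_exponents_def)
      obtain \<gamma> where \<gamma>: "\<gamma> < \<epsilon>\<^sub>0" "single \<gamma> 1 + m \<in> standard"
        "\<And>n. n \<in> eps0_exponents \<Longrightarrow> keys n \<subseteq> T \<Longrightarrow> \<not> (\<forall>\<beta>. lookup n \<beta> \<le> lookup m \<beta>) \<Longrightarrow>
          single \<gamma> 1 + n \<in> vanishing"
        using separating_variable[OF \<open>m \<in> standard\<close> T] by blast
      have var: "var \<gamma> \<in> eps0_polys" using \<gamma>(1) by (simp add: var_eq_monom)
      have kill: "single \<gamma> 1 + n \<in> vanishing" if "n \<in> M" for n
      proof (rule \<gamma>(3))
        show "\<not> (\<forall>\<beta>. lookup n \<beta> \<le> lookup m \<beta>)"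
        proof
          assume "\<forall>\<beta>. lookup n \<beta> \<le> lookup m \<beta>"
          then have *: "m = n + (m - n)" by (intro exponents_le_imp_add) simp
          then have "m - n \<in> eps0_exponents"
            using \<open>m \<in> standard\<close> by (metis DiffD1 eps0_exponents_add)
          then show False using not that * unfolding multiples_def by blast
        qed
      qed (use that M(1) in \<open>auto simp: T_def\<close>)
      have "cls (var \<gamma>) \<in> annihilator eps0_algebra J"
        unfolding annihilator_def
      proof (intro CollectI conjI ballI)
        show "cls (var \<gamma>) \<in> carrier eps0_algebra" using var by simp
        fix Y assume "Y \<in> J"
        then obtain q where q: "keys q \<subseteq> multiples M" "Y = cls q" by (auto simp: J)
        then have "q \<in> eps0_polys" using polys by auto
        have "keys (var \<gamma> * q) \<subseteq> vanishing"
        proof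
          fix k assume "k \<in> keys (var \<gamma> * q)"
          then obtain l where l: "l \<in> keys q" "k = single \<gamma> 1 + l"
            using keys_mult[of "var \<gamma>" q] by (auto simp: var_eq_monom)
          then obtain n j where "l = n + j" "n \<in> M" "j \<in> eps0_exponents"
            using q(1) by (auto simp: multiples_def)
          then show "k \<in> vanishing"
            using vanishing_add[OF kill, of n j] l(2) by (simp add: add.assoc)
        qed
        then show "cls (var \<gamma>) \<otimes>\<^bsub>eps0_algebra\<^esub> Y = \<zero>\<^bsub>eps0_algebra\<^esub>"
          using var \<open>q \<in> eps0_polys\<close> by (simp add: q(2) cls_mult cls_eq_zero_iff)
      qed
      with X have "cls p \<otimes>\<^bsub>eps0_algebra\<^esub> cls (var \<gamma>) = \<zero>\<^bsub>eps0_algebra\<^esub>"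
        by (simp add: annihilator_def p(2))
      then have "keys (var \<gamma> * p) \<subseteq> vanishing"
        using p(1) var by (simp add: cls_mult cls_eq_zero_iff mult.commute)
      moreover have "single \<gamma> 1 + m \<in> keys (var \<gamma> * p)"
        using m by (simp add: in_keys_iff var_eq_monom del: One_nat_def)
      ultimately show False using \<gamma>(2) by blast
    qed
    then show "X \<in> J" using p(2) by (auto simp: J)
  qed
  moreover have "J \<subseteq> carrier eps0_algebra" using polys by (auto simp: J)
  ultimately show ?thesis
    unfolding J_def[symmetric]
    using subset_double_annihilator[OF eps0_algebra.is_cring, of J] by blast
qed

section \<open>The grading\<close>

lemma exponents_degree_eq:
  assumes "finite S" "keys m \<subseteq> S"
  shows "exponents_degree m = (\<Sum>\<alpha>\<in>S. int (lookup m \<alpha> * delta \<alpha>))"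
  unfolding exponents_degree_def
  by (rule sum.mono_neutral_left) (use assms in \<open>auto simp: in_keys_iff\<close>)

lemma exponents_degree_add: "exponents_degree (m + n) = exponents_degree m + exponents_degree n"
proof -
  let ?S = "keys m \<union> keys n"
  have S: "finite ?S" "keys (m + n) \<subseteq> ?S" using keys_add[of m n] by auto
  show ?thesis
    using exponents_degree_eq[OF S] exponents_degree_eq[OF S(1), of m] exponents_degree_eq[OF S(1), of n]
    by (simp add: lookup_add sum.distrib algebra_simps)
qed

lemma exponents_degree_single: "exponents_degree (single \<alpha> k) = int (k * delta \<alpha>)"
  using exponents_degree_eq[of "{\<alpha>}" "single \<alpha> k"] by simp

text \<open>
  By positivity of \<open>\<delta>\<close>. So the component of degree \<open>0\<close> consists of the constants.
\<close>

lemma exponents_degree_zero_iff: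
  assumes "m \<in> eps0_exponents"
  shows "exponents_degree m = 0 \<longleftrightarrow> m = 0"
proof
  assume "exponents_degree m = 0"
  then have "\<forall>\<alpha>\<in>keys m. lookup m \<alpha> * delta \<alpha> = 0"
    unfolding exponents_degree_def by (subst (asm) sum_nonneg_eq_0_iff) auto
  moreover have "0 < delta \<alpha>" if "\<alpha> \<in> keys m" for \<alpha>
    using assms that by (intro delta_pos) (auto simp: eps0_exponents_def)
  ultimately have "keys m = {}"
    by (metis all_not_in_conv in_keys_iff less_irrefl mult_eq_0_iff)
  then show "m = 0" by simp
qed (simp add: exponents_degree_def)

definition of_degree :: "int \<Rightarrow> exponents set"
  where "of_degree d = {m. exponents_degree m = d}"

lemma poly_grading_iff: "p \<in> poly_grading d \<longleftrightarrow> p \<in> eps0_polys \<and> keys p \<subseteq> of_degree d"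
  by (auto simp: poly_grading_def of_degree_def)

lemma eps0_grading_eq: "eps0_grading d = cls ` poly_grading d"
  by (simp add: eps0_grading_def quotient_grading_def)

lemma poly_grading_eps0_polys: "p \<in> poly_grading d \<Longrightarrow> p \<in> eps0_polys"
  by (simp add: poly_grading_iff)

lemma poly_grading_closed:
  "0 \<in> poly_grading d"
  "p \<in> poly_grading d \<Longrightarrow> q \<in> poly_grading d \<Longrightarrow> p + q \<in> poly_grading d"
  "p \<in> poly_grading d \<Longrightarrow> q \<in> poly_grading e \<Longrightarrow> p * q \<in> poly_grading (d + e)"
  "p \<in> eps0_polys \<Longrightarrow> restrict_keys (of_degree d) p \<in> poly_grading d"
proof -
  show "p + q \<in> poly_grading d" if "p \<in> poly_grading d" "q \<in> poly_grading d"
    using that keys_add[of p q] unfolding poly_grading_iff by fastforce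
  show "p * q \<in> poly_grading (d + e)" if "p \<in> poly_grading d" "q \<in> poly_grading e"
    using that keys_mult[of p q] unfolding poly_grading_iff
    by (fastforce simp: of_degree_def exponents_degree_add)
qed (auto simp: poly_grading_iff)

lemma restrict_keys_poly_grading:
  assumes "p \<in> poly_grading e"
  shows "restrict_keys (of_degree d) p = (if d = e then p else 0)"
  by (rule poly_mapping_eqI)
    (use assms in \<open>auto simp: lookup_restrict_keys poly_grading_iff of_degree_def in_keys_iff subset_iff\<close>)

lemma restrict_keys_mult_homogeneous:
  assumes "u \<in> poly_grading e"
  shows "restrict_keys (of_degree (d + e)) (p * u) = restrict_keys (of_degree d) p * u"
proof -
  let ?p = "restrict_keys (of_degree d) p" and ?r = "restrict_keys (- of_degree d) p"
  have p: "p = ?p + ?r"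
    by (rule poly_mapping_eqI) (simp add: lookup_restrict_keys lookup_add)
  have "restrict_keys (of_degree (d + e)) (?p * u) = ?p * u"
  proof (rule poly_mapping_eqI)
    fix m
    have "m \<in> of_degree (d + e)" if "m \<in> keys (?p * u)"
      using that keys_mult[of ?p u] assms
      by (fastforce simp: of_degree_def poly_grading_iff exponents_degree_add)
    then show "lookup (restrict_keys (of_degree (d + e)) (?p * u)) m = lookup (?p * u) m"
      by (metis in_keys_iff lookup_restrict_keys)
  qed
  moreover have "restrict_keys (of_degree (d + e)) (?r * u) = 0"
  proof (rule poly_mapping_eqI)
    fix m
    have "m \<notin> of_degree (d + e)" if "m \<in> keys (?r * u)"
      using that keys_mult[of ?r u] assms
      by (fastforce simp: of_degree_def poly_grading_iff exponents_degree_add)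
    then show "lookup (restrict_keys (of_degree (d + e)) (?r * u)) m = lookup 0 m"
      by (metis in_keys_iff lookup_restrict_keys lookup_zero)
  qed
  ultimately show ?thesis
    by (subst p) (simp add: distrib_right restrict_keys_add)
qed

text \<open>
  The homogeneous component of degree \<open>d\<close>. It is well defined on classes because the ideal of
  relations is spanned by monomials.
\<close>

definition component :: "int \<Rightarrow> polynomial set \<Rightarrow> polynomial set"
  where "component d X = cls (restrict_keys (of_degree d) (normal_form X))"

lemma component_cls:
  assumes "p \<in> eps0_polys"
  shows "component d (cls p) = cls (restrict_keys (of_degree d) p)"
  unfolding component_def using assms
  by (subst cls_eq_iff) (auto simp: lookup_restrict_keys lookup_normal_form_cls)

lemma component_homogeneous:
  assumes "X \<in> carrier eps0_algebra" 
  shows "component d X \<in> eps0_grading d"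
  using assms poly_grading_closed(4) by (auto simp: component_def eps0_grading_eq)

lemma ideal_module_simps [simp]:
  "carrier (ideal_module R J) = J" "zero (ideal_module R J) = zero R"
  "add (ideal_module R J) = add R" "smult (ideal_module R J) = mult R"
  by (simp_all add: ideal_module_def)

lemma module_ideal_module:
  assumes "cring R" "ideal J R"
  shows "module R (ideal_module R J)"
proof -
  interpret cring R by fact
  interpret J: ideal J R by fact
  have "abelian_group (ideal_module R J)"
  proof (rule abelian_groupI)
    fix x assume "x \<in> carrier (ideal_module R J)"
    then show "\<exists>y\<in>carrier (ideal_module R J). y \<oplus>\<^bsub>ideal_module R J\<^esub> x = \<zero>\<^bsub>ideal_module R J\<^esub>"
      by (intro bexI[of _ "\<ominus>\<^bsub>R\<^esub> x"]) (auto simp: J.Icarr l_neg J.a_inv_closed[simplified])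
  qed (auto simp: J.a_closed J.Icarr a_ac J.zero_closed)
  then show ?thesis
    by (intro module.intro module_axioms.intro is_cring)
      (auto simp: J.I_l_closed J.Icarr l_distr r_distr m_assoc)
qed

lemma finsum_ideal_module:
  assumes "cring R" "ideal J R" "finite I" "f \<in> I \<rightarrow> J"
  shows "finsum (ideal_module R J) f I = finsum R f I"
proof -
  interpret cring R by fact
  interpret J: ideal J R by fact
  interpret M: module R "ideal_module R J" by (rule module_ideal_module[OF assms(1,2)])
  show ?thesis
    using assms(3,4)
  proof (induction I rule: finite_induct)
    case (insert i I)
    then have "f \<in> I \<rightarrow> J" "f i \<in> J" "f \<in> I \<rightarrow> carrier R" by (auto simp: J.Icarr Pi_iff)
    with insert show ?case
      by (simp add: M.finsum_insert finsum_insert J.Icarr)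
  qed simp
qed

lemma eps0_grading_carrier: "X \<in> eps0_grading d \<Longrightarrow> X \<in> carrier eps0_algebra"
  by (auto simp: eps0_grading_eq poly_grading_eps0_polys)

lemma eps0_grading_closed:
  assumes "X \<in> eps0_grading d" "Y \<in> eps0_grading d"
  shows "X \<oplus>\<^bsub>eps0_algebra\<^esub> Y \<in> eps0_grading d"
  using assms poly_grading_closed(2) by (auto simp: eps0_grading_eq cls_add poly_grading_eps0_polys)

lemma eps0_grading_mult:
  assumes "X \<in> eps0_grading d" "Y \<in> eps0_grading e"
  shows "X \<otimes>\<^bsub>eps0_algebra\<^esub> Y \<in> eps0_grading (d + e)"
  using assms poly_grading_closed(3) by (auto simp: eps0_grading_eq cls_mult poly_grading_eps0_polys)

lemma eps0_algebra_double:
  assumes "X \<in> carrier eps0_algebra"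
  shows "X \<oplus>\<^bsub>eps0_algebra\<^esub> X = \<zero>\<^bsub>eps0_algebra\<^esub>"
proof -
  obtain p where "p \<in> eps0_polys" "X = cls p" using assms by (auto simp: carrier_eps0_algebra)
  then show ?thesis by (simp add: cls_add cls_zero)
qed

lemma zero_in_eps0_grading: "\<zero>\<^bsub>eps0_algebra\<^esub> \<in> eps0_grading d"
  using poly_grading_closed(1) by (auto simp: cls_zero eps0_grading_eq)

text \<open>
  The components of \<open>X\<close> supply the required decomposition, and applying \<^const>\<open>component\<close> to any
  other decomposition recovers its terms.
\<close>

lemma graded_module_ideal:
  assumes J: "ideal J eps0_algebra" and comp: "\<And>d X. X \<in> J \<Longrightarrow> component d X \<in> J"
  shows "graded_module eps0_algebra eps0_grading
    (ideal_module eps0_algebra J) (ideal_grading eps0_grading J)"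
proof -
  let ?M = "ideal_module eps0_algebra J" and ?H = "ideal_grading eps0_grading J"
  interpret J: ideal J eps0_algebra by fact
  interpret M: module eps0_algebra ?M
    by (rule module_ideal_module[OF eps0_algebra.is_cring J])
  have sub: "additive_subgroup (?H d) ?M" for d
  proof (rule additive_subgroup.intro, rule group.subgroupI[OF M.a_group])
    show "?H d \<subseteq> carrier (add_monoid ?M)" by (auto simp: ideal_grading_def)
    show "?H d \<noteq> {}" 
      unfolding ideal_grading_def using zero_in_eps0_grading J.zero_closed by blast
    fix X assume X: "X \<in> ?H d"
    then have "X \<in> carrier ?M" "X \<oplus>\<^bsub>?M\<^esub> X = \<zero>\<^bsub>?M\<^esub>"
      by (auto simp: ideal_grading_def eps0_algebra_double J.Icarr)
    then have "\<ominus>\<^bsub>?M\<^esub> X = X" by (intro M.minus_equality)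
    then show "inv\<^bsub>add_monoid ?M\<^esub> X \<in> ?H d" using X by (simp add: a_inv_def)
    fix Y assume "Y \<in> ?H d"
    then show "X \<otimes>\<^bsub>add_monoid ?M\<^esub> Y \<in> ?H d"
      using X eps0_grading_closed by (auto simp: ideal_grading_def J.a_closed)
  qed
  have decomposition: "\<exists>!f. (\<forall>d. f d \<in> ?H d) \<and> finite {d. f d \<noteq> \<zero>\<^bsub>?M\<^esub>} \<and>
      X = finsum ?M f {d. f d \<noteq> \<zero>\<^bsub>?M\<^esub>}" if X: "X \<in> carrier ?M" for X
  proof (rule ex1I)
    have X: "X \<in> J" "X \<in> carrier eps0_algebra" using that J.Icarr by auto
    define p where "p = normal_form X"
    have p: "p \<in> eps0_polys" "X = cls p" using X by (simp_all add: p_def)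
    let ?r = "\<lambda>d. restrict_keys (of_degree d) p" and ?f = "\<lambda>d. component d X"
    have f_eq: "?f d = cls (?r d)" for d
      using component_cls[OF p(1), of d] unfolding p(2)[symmetric] .
    let ?D = "{d. ?f d \<noteq> \<zero>\<^bsub>?M\<^esub>}"
    have "?D \<subseteq> exponents_degree ` keys p"
    proof
      fix d assume "d \<in> ?D"
      then have "cls (?r d) \<noteq> cls 0" by (simp only: f_eq cls_zero mem_Collect_eq ideal_module_simps not_False_eq_True)
      then have "?r d \<noteq> 0" by metis
      then have "keys p \<inter> of_degree d \<noteq> {}" by (metis keys_eq_empty keys_restrict_keys)
      then show "d \<in> exponents_degree ` keys p" by (auto simp: of_degree_def)
    qed
    then have fin: "finite ?D" by (rule finite_subset) simp
    have H: "?f d \<in> ?H d" for d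
      using comp[OF X(1)] component_homogeneous[OF X(2)] by (simp add: ideal_grading_def)
    have "finsum ?M ?f ?D = finsum eps0_algebra ?f ?D"
      by (rule finsum_ideal_module[OF eps0_algebra.is_cring J fin]) (use comp[OF X(1)] in blast)
    also have "\<dots> = cls (\<Sum>d\<in>?D. ?r d)"
      unfolding f_eq using fin p(1) by (intro finsum_cls) (simp_all add: f_eq)
    also have "\<dots> = cls p"
    proof (subst cls_eq_iff)
      show "\<forall>m\<in>standard. lookup (\<Sum>d\<in>?D. ?r d) m = lookup p m"
      proof
        fix m assume m: "m \<in> standard"
        have "lookup (\<Sum>d\<in>?D. ?r d) m = (\<Sum>d\<in>?D. if exponents_degree m = d then lookup p m else 0)"
          by (simp add: lookup_sum lookup_restrict_keys of_degree_def)
        also have "\<dots> = (if exponents_degree m \<in> ?D then lookup p m else 0)"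
          using fin by simp
        also have "\<dots> = lookup p m"
        proof (cases "exponents_degree m \<in> ?D")
          case False
          then have "keys (?r (exponents_degree m)) \<subseteq> vanishing"
            using p(1) by (simp add: f_eq cls_eq_zero_iff)
          then have "m \<notin> keys p" using m by (auto simp: of_degree_def)
          then show ?thesis by (simp add: in_keys_iff)
        qed simp
        finally show "lookup (\<Sum>d\<in>?D. ?r d) m = lookup p m" .
      qed
    qed (use p(1) in \<open>auto intro: eps0_polys_sum\<close>)
    finally show "(\<forall>d. ?f d \<in> ?H d) \<and> finite ?D \<and> X = finsum ?M ?f ?D"
      using H fin p(2) by simp
  next
    fix f assume f: "(\<forall>d. f d \<in> ?H d) \<and> finite {d. f d \<noteq> \<zero>\<^bsub>?M\<^esub>} \<and>
      X = finsum ?M f {d. f d \<noteq> \<zero>\<^bsub>?M\<^esub>}"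
    let ?D = "{d. f d \<noteq> \<zero>\<^bsub>?M\<^esub>}"
    have "\<forall>d. \<exists>p\<in>poly_grading d. f d = cls p"
      using f by (auto simp: ideal_grading_def eps0_grading_eq)
    then obtain g where g: "\<And>d. g d \<in> poly_grading d" "\<And>d. f d = cls (g d)" by metis
    have gp: "g d \<in> eps0_polys" for d using g(1) poly_grading_eps0_polys by blast
    have "finsum ?M f ?D = finsum eps0_algebra f ?D"
      by (rule finsum_ideal_module[OF eps0_algebra.is_cring J]) (use f in \<open>auto simp: ideal_grading_def\<close>)
    also have "\<dots> = cls (\<Sum>d\<in>?D. g d)"
      unfolding g(2) using f gp by (intro finsum_cls) (simp_all add: g(2))
    finally have X: "X = cls (\<Sum>d\<in>?D. g d)" using f by simp
    show "f = (\<lambda>d. component d X)"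
    proof
      fix d
      have "restrict_keys (of_degree d) (\<Sum>e\<in>?D. g e) = (\<Sum>e\<in>?D. if d = e then g e else 0)"
      proof (rule poly_mapping_eqI)
        fix m
        have "lookup (restrict_keys (of_degree d) (\<Sum>e\<in>?D. g e)) m =
            (\<Sum>e\<in>?D. lookup (restrict_keys (of_degree d) (g e)) m)"
          by (simp add: lookup_restrict_keys lookup_sum)
        then show "lookup (restrict_keys (of_degree d) (\<Sum>e\<in>?D. g e)) m =
            lookup (\<Sum>e\<in>?D. if d = e then g e else 0) m"
          by (simp add: restrict_keys_poly_grading[OF g(1)] lookup_sum)
      qed
      also have "\<dots> = (if d \<in> ?D then g d else 0)" using f by simp
      finally have "component d X = cls (if d \<in> ?D then g d else 0)"
        unfolding X using gp by (subst component_cls) (simp_all add: eps0_polys_sum)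
      also have "\<dots> = f d" by (auto simp: g(2)[symmetric] cls_zero)
      finally show "f d = component d X" ..
    qed
  qed
  have "a \<odot>\<^bsub>?M\<^esub> x \<in> ?H (d + e)" if "a \<in> eps0_grading d" "x \<in> ?H e" for a x d e
    using that eps0_grading_mult by (auto simp: ideal_grading_def eps0_grading_eq poly_grading_eps0_polys intro!: J.I_l_closed)
  then show ?thesis
    unfolding graded_module_def is_grading_def using M.module_axioms sub decomposition by blast
qed

section \<open>A principal ideal that is not a double annihilator\<close>

lemma principal_ideal_eps0_algebra:
  assumes "u \<in> eps0_polys"
  shows "genideal eps0_algebra {cls u} = {cls (q * u) | q. q \<in> eps0_polys}"
proof -
  have "genideal eps0_algebra (cls ` {u}) = cls ` genideal poly_ring {u}"
    using assms by (intro genideal_cls) simp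
  also have "genideal poly_ring {u} = {q * u | q. q \<in> eps0_polys}"
    using poly_ring.cgenideal_eq_genideal[OF assms] by (auto simp: cgenideal_def)
  finally show ?thesis by auto
qed

text \<open>
  Since common multiples of \<open>a\<close> and \<open>b\<close> vanish, multiples of \<open>a\<close> never cancel against multiples of
  \<open>b\<close> in the algebra, so that only common annihilators of \<open>a\<close> and \<open>b\<close> annihilate their sum.
\<close>

locale obstructing_binomial =
  fixes a b :: exponents
  assumes standard_a: "a \<in> standard"
    and standard_b: "b \<in> standard"
    and same_degree: "exponents_degree a = exponents_degree b"
    and overlap_vanishes: "\<And>j k. a + j = b + k \<Longrightarrow> a + j \<in> eps0_exponents \<Longrightarrow> a + j \<in> vanishing"
    and not_multiple_a: "\<And>k. a \<noteq> b + k"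
    and not_multiple_b: "\<And>k. b \<noteq> a + k"
begin

definition u :: polynomial
  where "u = monom a + monom b"

abbreviation J :: "polynomial set set"
  where "J \<equiv> genideal eps0_algebra {cls u}"

lemma monom_a_eps0_polys [simp]: "monom a \<in> eps0_polys" and u_eps0_polys [simp]: "u \<in> eps0_polys"
  using standard_a standard_b by (auto simp: u_def)

lemma u_homogeneous: "u \<in> poly_grading (exponents_degree a)"
  unfolding u_def using standard_a standard_b same_degree
  by (intro poly_grading_closed) (auto simp: poly_grading_iff of_degree_def)

lemma J_eq: "J = {cls (q * u) | q. q \<in> eps0_polys}"
  by (rule principal_ideal_eps0_algebra) simp

lemma ideal_J: "ideal J eps0_algebra"
  by (rule eps0_algebra.genideal_ideal) simp

text \<open>
  A standard monomial of \<open>q * monom a\<close> is no multiple of \<open>b\<close>, so it has the same coefficient in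
  \<open>q * u\<close>.
\<close>

lemma annihilates_monom_a:
  assumes "q \<in> eps0_polys" "cls (q * u) = \<zero>\<^bsub>eps0_algebra\<^esub>"
  shows "cls (q * monom a) = \<zero>\<^bsub>eps0_algebra\<^esub>"
proof -
  have qu: "keys (q * u) \<subseteq> vanishing"
    using assms by (simp add: cls_eq_zero_iff)
  have "m \<in> vanishing" if m: "m \<in> keys (q * monom a)" for m
  proof (rule ccontr)
    assume not: "m \<notin> vanishing"
    obtain j where j: "j \<in> keys q" "m = a + j"
      using m keys_mult[of q "monom a"] by (auto simp: add.commute)
    then have E: "m \<in> eps0_exponents"
      using assms(1) standard_a by (auto simp: eps0_polys_iff)
    have "lookup (monom b * q) m = 0"
      using overlap_vanishes[of j] not E j(2) by (intro lookup_monom_mult_not_dvd) metis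
    moreover have "lookup (monom a * q) m = lookup q j"
      by (simp add: j(2))
    ultimately have "lookup (q * u) m = lookup q j"
      unfolding u_def distrib_left lookup_add by (simp only: mult.commute add_0_right)
    then have "m \<in> keys (q * u)" using j(1) by (simp add: in_keys_iff)
    then show False using qu not by blast
  qed
  then show ?thesis
    using assms(1) by (subst cls_eq_zero_iff) auto
qed

text \<open>
  Both the coefficient of \<open>a\<close> and the coefficient of \<open>b\<close> in \<open>q * u\<close> equal the constant term of \<open>q\<close>.
\<close>

lemma monom_a_not_in_J: "cls (monom a) \<notin> J"
proof
  assume "cls (monom a) \<in> J"
  then obtain q where q: "q \<in> eps0_polys" "cls (monom a) = cls (q * u)"
    by (auto simp: J_eq)
  then have *: "lookup (monom a) m = lookup (q * u) m" if "m \<in> standard" for m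
    using that by (subst (asm) cls_eq_iff) auto
  have qu: "lookup (q * u) m = lookup (monom a * q) m + lookup (monom b * q) m" for m
    unfolding u_def distrib_left lookup_add by (simp only: mult.commute)
  have "lookup (q * u) a = lookup q 0"
    unfolding qu using lookup_monom_mult[of a q 0] lookup_monom_mult_not_dvd[OF not_multiple_a] by simp
  moreover have "lookup (q * u) b = lookup q 0"
    unfolding qu using lookup_monom_mult[of b q 0] lookup_monom_mult_not_dvd[OF not_multiple_b] by simp
  ultimately have "lookup (monom a) a = lookup (monom a) b"
    using *[OF standard_a] *[OF standard_b] by simp
  then show False
    using not_multiple_a[of 0] by (auto simp: lookup_monom split: if_splits)
qed

lemma finitely_generated_J: "finitely_generated_ideal eps0_algebra eps0_grading J"
  unfolding finitely_generated_ideal_def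
  using u_homogeneous by (intro exI[of _ "{cls u}"]) (auto simp: homogeneous_elements_def eps0_grading_eq)

text \<open>
  A monomial ideal contains with \<open>u\<close> also its monomial \<open>a\<close>.
\<close>

lemma not_monomial_J: "\<not> monomial_ideal J"
proof
  assume "monomial_ideal J"
  then obtain S where S: "S \<subseteq> eps0_monomials" "J = genideal eps0_algebra S"
    unfolding monomial_ideal_def by (elim exE conjE)
  have "S \<subseteq> (\<lambda>m. cls (monom m)) ` eps0_exponents"
    using S(1) by (auto simp: eps0_monomials_def)
  then obtain M where M: "M \<subseteq> eps0_exponents" "S = (\<lambda>m. cls (monom m)) ` M"
    by (auto simp: subset_image_iff)
  have J: "J = cls ` {p. keys p \<subseteq> multiples M}"
    using genideal_eps0_monomials[OF M(1)] S(2) M(2) by (simp add: image_image)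
  have "cls u \<in> J" using eps0_algebra.genideal_self' by simp
  then obtain p where p: "keys p \<subseteq> multiples M" "cls u = cls p"
    unfolding J by fast
  have "p \<in> eps0_polys" using p(1) multiples_subset[OF M(1)] by (auto simp: eps0_polys_iff)
  then have "lookup u a = lookup p a"
    using cls_eq_iff[of u p] p(2) standard_a by simp
  moreover have "lookup u a = 1"
    using not_multiple_a[of 0] by (auto simp: u_def lookup_add lookup_monom)
  ultimately have "a \<in> multiples M" using p(1) by (auto simp: in_keys_iff)
  then have "cls (monom a) \<in> J" unfolding J by (intro imageI) simp
  then show False using monom_a_not_in_J by blast
qed

lemma double_annihilator_J: "cls (monom a) \<in> annihilator eps0_algebra (annihilator eps0_algebra J)"
proof -
  have "cls (monom a) \<otimes>\<^bsub>eps0_algebra\<^esub> X = \<zero>\<^bsub>eps0_algebra\<^esub>" if X: "X \<in> annihilator eps0_algebra J" for X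
  proof -
    obtain q where q: "q \<in> eps0_polys" "X = cls q"
      using X by (auto simp: annihilator_def carrier_eps0_algebra)
    have "cls u \<in> J" using eps0_algebra.genideal_self' by simp
    then have "cls (q * u) = \<zero>\<^bsub>eps0_algebra\<^esub>"
      using X q by (auto simp: annihilator_def cls_mult)
    from annihilates_monom_a[OF q(1) this] show ?thesis
      using q by (simp add: cls_mult mult.commute)
  qed
  then show ?thesis by (simp add: annihilator_def)
qed

lemma J_not_double_annihilator: "J \<noteq> annihilator eps0_algebra (annihilator eps0_algebra J)"
  using double_annihilator_J monom_a_not_in_J by blast

lemma component_J:
  assumes "X \<in> J"
  obtains w where "w \<in> poly_grading (d - exponents_degree a)" "component d X = cls (w * u)"
proof -
  obtain q where q: "q \<in> eps0_polys" "X = cls (q * u)" using assms by (auto simp: J_eq)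
  let ?w = "restrict_keys (of_degree (d - exponents_degree a)) q"
  have "component d X = cls (restrict_keys (of_degree d) (q * u))"
    using q by (simp add: component_cls)
  also have "\<dots> = cls (?w * u)"
    using restrict_keys_mult_homogeneous[OF u_homogeneous, of "d - exponents_degree a" q] by simp
  finally show ?thesis
    using that[of ?w] poly_grading_closed(4)[OF q(1)] by simp
qed

lemma component_J_closed: "X \<in> J \<Longrightarrow> component d X \<in> J"
  by (erule component_J[of _ d]) (auto simp: J_eq poly_grading_eps0_polys)

text \<open>
  The obstruction is the homomorphism \<open>q * u \<mapsto> q * monom a\<close> on \<open>J\<close>. It is well defined since the
  annihilator of \<open>u\<close> annihilates \<open>monom a\<close>, and it has degree \<open>0\<close> since \<open>u\<close> and \<open>monom a\<close> have
  the same degree.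
\<close>

theorem not_self_injective: "\<not> self_injective eps0_algebra eps0_grading"
proof
  assume inj: "self_injective eps0_algebra eps0_grading"
  let ?M = "ideal_module eps0_algebra J" and ?H = "ideal_grading eps0_grading J"
  let ?N = "ideal_module eps0_algebra (carrier eps0_algebra)"
  interpret J: ideal J eps0_algebra by (rule ideal_J)
  have "ideal_grading eps0_grading (carrier eps0_algebra) = eps0_grading"
    by (auto simp: ideal_grading_def eps0_grading_eq poly_grading_eps0_polys fun_eq_iff)
  then have N: "graded_module eps0_algebra eps0_grading ?N eps0_grading"
    using graded_module_ideal[OF eps0_algebra.oneideal] by (simp add: component_def)
  have M: "graded_module eps0_algebra eps0_grading ?M ?H"
    by (rule graded_module_ideal[OF ideal_J component_J_closed])
  have incl: "(\<lambda>X. X) \<in> graded_hom eps0_algebra ?M ?H ?N eps0_grading"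
    by (auto simp: graded_hom_def ideal_grading_def J.Icarr)
  define f where "f X = cls ((SOME q. q \<in> eps0_polys \<and> X = cls (q * u)) * monom a)" for X
  have f: "f (cls (q * u)) = cls (q * monom a)" if q: "q \<in> eps0_polys" for q
  proof -
    let ?q = "SOME q'. q' \<in> eps0_polys \<and> cls (q * u) = cls (q' * u)"
    have q': "?q \<in> eps0_polys" "cls (q * u) = cls (?q * u)"
      using someI[of "\<lambda>q'. q' \<in> eps0_polys \<and> cls (q * u) = cls (q' * u)" q] q by auto
    have "cls ((q + ?q) * u) = cls (q * u) \<oplus>\<^bsub>eps0_algebra\<^esub> cls (?q * u)"
      using q q'(1) by (simp add: cls_add distrib_right)
    also have "\<dots> = \<zero>\<^bsub>eps0_algebra\<^esub>"
      unfolding q'(2)[symmetric] using q by (intro eps0_algebra_double) simp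
    finally have "cls ((q + ?q) * monom a) = \<zero>\<^bsub>eps0_algebra\<^esub>"
      using q q'(1) by (intro annihilates_monom_a) simp_all
    then have "keys (q * monom a + ?q * monom a) \<subseteq> vanishing"
      using q q'(1) by (subst (asm) cls_eq_zero_iff) (simp_all add: distrib_right)
    then have "q * monom a + ?q * monom a \<in> eps0_ideal" by (simp add: eps0_ideal_eq)
    then have "cls (q * monom a) = cls (?q * monom a)"
      using poly_ring.quotient_eq_iff_same_a_r_cos[OF ideal_eps0_ideal, of "q * monom a" "?q * monom a"]
        q q'(1) by (simp add: poly_ring_minus)
    then show ?thesis by (simp add: f_def)
  qed
  have f_hom: "f \<in> graded_hom eps0_algebra ?M ?H ?N eps0_grading"
    unfolding graded_hom_def
  proof (intro CollectI conjI ballI allI)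
    show "f \<in> carrier ?M \<rightarrow> carrier ?N" by (auto simp: J_eq f)
    fix X Y assume "X \<in> carrier ?M" "Y \<in> carrier ?M"
    then obtain p q where pq: "p \<in> eps0_polys" "X = cls (p * u)" "q \<in> eps0_polys" "Y = cls (q * u)"
      by (auto simp: J_eq)
    then have "X \<oplus>\<^bsub>?M\<^esub> Y = cls ((p + q) * u)"
      by (simp add: cls_add distrib_right)
    then show "f (X \<oplus>\<^bsub>?M\<^esub> Y) = f X \<oplus>\<^bsub>?N\<^esub> f Y"
      using pq f[of "p + q"] by (simp add: f cls_add distrib_right)
  next
    fix C X assume "C \<in> carrier eps0_algebra" "X \<in> carrier ?M"
    then obtain c q where q: "c \<in> eps0_polys" "C = cls c" "q \<in> eps0_polys" "X = cls (q * u)"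
      by (auto simp: J_eq carrier_eps0_algebra)
    then have "C \<odot>\<^bsub>?M\<^esub> X = cls ((c * q) * u)"
      by (simp add: cls_mult mult.assoc)
    then show "f (C \<odot>\<^bsub>?M\<^esub> X) = C \<odot>\<^bsub>?N\<^esub> f X"
      using q f[of "c * q"] by (simp add: f cls_mult mult.assoc)
  next
    fix d show "f ` ?H d \<subseteq> eps0_grading d"
    proof safe
      fix X assume "X \<in> ?H d"
      then have X: "X \<in> J" "X \<in> eps0_grading d" by (auto simp: ideal_grading_def)
      obtain p where p: "p \<in> poly_grading d" "X = cls p" using X(2) by (auto simp: eps0_grading_eq)
      then have "component d X = X"
        using restrict_keys_poly_grading[OF p(1), of d] by (simp add: component_cls poly_grading_eps0_polys)
      then obtain w where w: "w \<in> poly_grading (d - exponents_degree a)" "X = cls (w * u)"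
        using component_J[OF X(1), of d] by metis
      have "monom a \<in> poly_grading (exponents_degree a)"
        using standard_a by (auto simp: poly_grading_iff of_degree_def)
      from poly_grading_closed(3)[OF w(1) this] have "w * monom a \<in> poly_grading d" by simp
      then show "f X \<in> eps0_grading d"
        using f[of w] w by (auto simp: eps0_grading_eq poly_grading_eps0_polys)
    qed
  qed
  obtain g where g: "g \<in> graded_hom eps0_algebra ?N eps0_grading ?N eps0_grading" "\<forall>X\<in>J. g X = f X"
    using inj[unfolded self_injective_def graded_injective_def, rule_format,
        OF M N incl inj_on_id2 f_hom] by auto
  have "g (cls 1) \<in> carrier eps0_algebra" using g(1) by (auto simp: graded_hom_def)
  then obtain c where c: "c \<in> eps0_polys" "g (cls 1) = cls c" by (auto simp: carrier_eps0_algebra)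
  have "g (cls u \<otimes>\<^bsub>eps0_algebra\<^esub> cls 1) = cls u \<otimes>\<^bsub>eps0_algebra\<^esub> g (cls 1)"
    using g(1) by (simp add: graded_hom_def)
  then have "g (cls u) = cls (c * u)"
    using c by (simp add: cls_mult mult.commute)
  moreover have "cls u \<in> J" using eps0_algebra.genideal_self' by simp
  then have "g (cls u) = cls (monom a)" using g(2) f[of 1] by simp
  ultimately have "cls (monom a) \<in> J" using c(1) by (auto simp: J_eq)
  then show False using monom_a_not_in_J by blast
qed

end

text \<open>
  The exponents are crosswise multiples of the degrees of \<open>x\<^sub>0\<close> and \<open>x\<^sub>1\<close>, which makes the degrees
  equal; the common factor \<open>N\<close> exceeds \<open>\<mu>(0, 1)\<close>, which makes the product vanish.
\<close>

lemma obstructing_binomial_exists: "\<exists>a b. obstructing_binomial a b"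
proof -
  define N where "N = Suc (mu 0 1)"
  define a b where "a = single (0 :: countable_ordinal) (N * delta 1)"
    and "b = single (1 :: countable_ordinal) (N * delta 0)"
  have pos: "0 < delta 0" "0 < delta 1"
    by (rule delta_pos[OF epsilon_0_pos], rule delta_pos[OF one_less_epsilon_0])
  have ne: "0 \<noteq> (1 :: countable_ordinal)" by (rule less_imp_neq[OF ordinal_one_pos])
  have std: "a \<in> standard" "b \<in> standard"
    using pure_power_standard[OF epsilon_0_pos] pure_power_standard[OF one_less_epsilon_0]
    by (simp_all add: a_def b_def)
  have a: "N \<le> lookup a 0" "lookup a 1 = 0" and b: "N \<le> lookup b 1" "lookup b 0 = 0"
    using pos ne by (auto simp: a_def b_def lookup_single)
  have "obstructing_binomial a b"
  proof
    show "a \<in> standard" "b \<in> standard" by (fact std)+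
    show "exponents_degree a = exponents_degree b"
      by (simp add: a_def b_def exponents_degree_single)
    show "a \<noteq> b + k" for k
    proof
      assume "a = b + k"
      from arg_cong[OF this, of "\<lambda>m. lookup m 1"] show False using a b by (simp add: lookup_add N_def)
    qed
    show "b \<noteq> a + k" for k
    proof
      assume "b = a + k"
      from arg_cong[OF this, of "\<lambda>m. lookup m 0"] show False using a b by (simp add: lookup_add N_def)
    qed
    fix j k assume *: "a + j = b + k" "a + j \<in> eps0_exponents"
    have "1 + mu 1 0 \<le> lookup (a + j) 0" using a(1) mu_commute[of 1 0] by (simp add: lookup_add N_def)
    moreover have "1 \<le> lookup (a + j) 1" unfolding *(1) using b(1) by (simp add: lookup_add N_def)
    ultimately show "a + j \<in> vanishing"
      unfolding vanishing_def using *(2) ne[symmetric]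
      by (intro CollectI conjI exI[of _ "1 :: countable_ordinal"] exI[of _ "0 :: countable_ordinal"])
  qed
  then show ?thesis by blast
qed

theorem not_self_injective_eps0_algebra: "\<not> self_injective eps0_algebra eps0_grading"
  using obstructing_binomial_exists obstructing_binomial.not_self_injective by blast

section \<open>Total incoherence\<close>

lemma free_module_simps [simp]:
  "carrier (free_module R ds) = ({..<length ds} \<rightarrow>\<^sub>E carrier R)"
  "zero (free_module R ds) = (\<lambda>i\<in>{..<length ds}. \<zero>\<^bsub>R\<^esub>)"
  "add (free_module R ds) = (\<lambda>f g. \<lambda>i\<in>{..<length ds}. f i \<oplus>\<^bsub>R\<^esub> g i)"
  "smult (free_module R ds) = (\<lambda>a f. \<lambda>i\<in>{..<length ds}. a \<otimes>\<^bsub>R\<^esub> f i)"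
  by (simp_all add: free_module_def)

definition unit_vector :: "('a, 'x) ring_scheme \<Rightarrow> int list \<Rightarrow> nat \<Rightarrow> nat \<Rightarrow> 'a"
  where "unit_vector R ds j = (\<lambda>i\<in>{..<length ds}. if i = j then \<one>\<^bsub>R\<^esub> else \<zero>\<^bsub>R\<^esub>)"

text \<open>
  Proved by filling in the coordinates of \<open>x\<close> one at a time. It is applied to the map from a free
  module onto an ideal and to the coordinates of a map between free modules.
\<close>

lemma linear_expansion:
  assumes "cring R"
    and closed: "\<And>x. x \<in> carrier (free_module R ds) \<Longrightarrow> f x \<in> carrier R"
    and add: "\<And>x y. x \<in> carrier (free_module R ds) \<Longrightarrow> y \<in> carrier (free_module R ds) \<Longrightarrow>
      f (x \<oplus>\<^bsub>free_module R ds\<^esub> y) = f x \<oplus>\<^bsub>R\<^esub> f y"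
    and scale: "\<And>a x. a \<in> carrier R \<Longrightarrow> x \<in> carrier (free_module R ds) \<Longrightarrow>
      f (a \<odot>\<^bsub>free_module R ds\<^esub> x) = a \<otimes>\<^bsub>R\<^esub> f x"
    and x: "x \<in> carrier (free_module R ds)"
  shows "f x = finsum R (\<lambda>l. x l \<otimes>\<^bsub>R\<^esub> f (unit_vector R ds l)) {..<length ds}"
proof -
  interpret cring R by fact
  let ?F = "free_module R ds" and ?r = "length ds"
  have x_closed: "x i \<in> carrier R" if "i < ?r" for i using x that by auto
  have e: "unit_vector R ds i \<in> carrier ?F" for i by (auto simp: unit_vector_def)
  define t where "t n = (\<lambda>i\<in>{..<?r}. if i < n then x i else \<zero>\<^bsub>R\<^esub>)" for n
  have t: "t n \<in> carrier ?F" for n using x_closed by (auto simp: t_def)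
  have "f (t n) = finsum R (\<lambda>l. x l \<otimes>\<^bsub>R\<^esub> f (unit_vector R ds l)) {..<n}" if "n \<le> ?r" for n
    using that
  proof (induction n)
    case 0
    have "t 0 = \<zero>\<^bsub>R\<^esub> \<odot>\<^bsub>?F\<^esub> t 0" by (auto simp: t_def restrict_def)
    then have "f (t 0) = \<zero>\<^bsub>R\<^esub> \<otimes>\<^bsub>R\<^esub> f (t 0)" using scale[OF zero_closed t[of 0]] by metis
    then show ?case using closed[OF t] by simp
  next
    case (Suc n)
    let ?e = "unit_vector R ds n"
    have n: "n < ?r" using Suc.prems by simp
    have scaled: "x n \<odot>\<^bsub>?F\<^esub> ?e \<in> carrier ?F"
      using x_closed[OF n] by (auto simp: unit_vector_def)
    have "t (Suc n) = t n \<oplus>\<^bsub>?F\<^esub> (x n \<odot>\<^bsub>?F\<^esub> ?e)"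
      using x_closed n by (auto simp: t_def unit_vector_def restrict_def fun_eq_iff less_Suc_eq)
    then have "f (t (Suc n)) = f (t n) \<oplus>\<^bsub>R\<^esub> x n \<otimes>\<^bsub>R\<^esub> f ?e"
      using add[OF t[of n] scaled] scale[OF x_closed[OF n] e[of n]] by metis
    also have "\<dots> = finsum R (\<lambda>l. x l \<otimes>\<^bsub>R\<^esub> f (unit_vector R ds l)) {..<Suc n}"
    proof -
      have "(\<lambda>l. x l \<otimes>\<^bsub>R\<^esub> f (unit_vector R ds l)) \<in> {..<n} \<rightarrow> carrier R"
        using x_closed closed[OF e] n by (intro Pi_I m_closed) simp_all
      moreover have "x n \<otimes>\<^bsub>R\<^esub> f ?e \<in> carrier R" using x_closed[OF n] closed[OF e] by simp
      ultimately show ?thesis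
        using Suc by (simp add: lessThan_Suc finsum_insert a_comm)
    qed
    finally show ?case .
  qed
  from this[of ?r] have "f (t ?r) = finsum R (\<lambda>l. x l \<otimes>\<^bsub>R\<^esub> f (unit_vector R ds l)) {..<?r}" by simp
  moreover have "t ?r = x"
    using x by (auto simp: t_def fun_eq_iff PiE_def extensional_def)
  ultimately show ?thesis by simp
qed

lemma normal_form_linear:
  assumes "\<And>x. x \<in> carrier (free_module eps0_algebra ds) \<Longrightarrow> f x \<in> carrier eps0_algebra"
    and "\<And>x y. x \<in> carrier (free_module eps0_algebra ds) \<Longrightarrow> y \<in> carrier (free_module eps0_algebra ds) \<Longrightarrow>
      f (x \<oplus>\<^bsub>free_module eps0_algebra ds\<^esub> y) = f x \<oplus>\<^bsub>eps0_algebra\<^esub> f y"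
    and "\<And>a x. a \<in> carrier eps0_algebra \<Longrightarrow> x \<in> carrier (free_module eps0_algebra ds) \<Longrightarrow>
      f (a \<odot>\<^bsub>free_module eps0_algebra ds\<^esub> x) = a \<otimes>\<^bsub>eps0_algebra\<^esub> f x"
    and x: "x \<in> carrier (free_module eps0_algebra ds)" and m: "m \<in> standard"
  shows "lookup (normal_form (f x)) m =
    (\<Sum>l<length ds. lookup (normal_form (x l) * normal_form (f (unit_vector eps0_algebra ds l))) m)"
proof -
  let ?e = "unit_vector eps0_algebra ds" and ?r = "length ds"
  have e: "f (?e l) \<in> carrier eps0_algebra" for l
    by (rule assms(1)) (auto simp: unit_vector_def)
  have xl: "x l \<in> carrier eps0_algebra" if "l < ?r" for l using x that by auto
  have "f x = finsum eps0_algebra (\<lambda>l. x l \<otimes>\<^bsub>eps0_algebra\<^esub> f (?e l)) {..<?r}"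
    by (rule linear_expansion[OF eps0_algebra.is_cring assms(1-3) x])
  also have "\<dots> = finsum eps0_algebra (\<lambda>l. cls (normal_form (x l) * normal_form (f (?e l)))) {..<?r}"
    using e xl by (intro eps0_algebra.finsum_cong') (simp_all flip: cls_mult)
  also have "\<dots> = cls (\<Sum>l<?r. normal_form (x l) * normal_form (f (?e l)))"
    using e xl by (intro finsum_cls) simp_all
  finally have "normal_form (f x) = normal_form (cls (\<Sum>l<?r. normal_form (x l) * normal_form (f (?e l))))"
    by simp
  moreover have "(\<Sum>l<?r. normal_form (x l) * normal_form (f (?e l))) \<in> eps0_polys"
    using e xl by (intro eps0_polys_sum) simp_all
  ultimately show ?thesis
    using m by (simp add: lookup_normal_form_cls lookup_sum)
qed

text \<open>
  Used to see that the generators of a proper ideal have no constant term.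
\<close>

lemma homogeneous_with_constant_term:
  assumes "X \<in> eps0_grading d" "lookup (normal_form X) 0 \<noteq> 0"
  shows "X = \<one>\<^bsub>eps0_algebra\<^esub>"
proof -
  obtain p where p: "p \<in> poly_grading d" "X = cls p" using assms(1) by (auto simp: eps0_grading_eq)
  then have P: "p \<in> eps0_polys" "keys p \<subseteq> of_degree d" by (auto simp: poly_grading_iff)
  have "lookup p 0 \<noteq> 0"
    using assms(2) by (simp add: p(2) lookup_normal_form_cls[OF P(1)])
  then have "0 \<in> keys p" by (simp add: in_keys_iff)
  then have "d = 0" using P(2) by (auto simp: of_degree_def exponents_degree_def)
  then have "keys p \<subseteq> {0}"
    using P exponents_degree_zero_iff by (auto simp: of_degree_def eps0_polys_iff)
  with \<open>0 \<in> keys p\<close> have "keys p = {0}" by blast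
  then have "p = 1" using poly_eq_sum_monom[of p] by simp
  then show ?thesis by (simp add: p(2) cls_one)
qed

text \<open>
  A presentation need not be minimal, so the relation with constant part \<open>e\<^sub>i\<close> found below is
  contradictory only for suitable \<open>i\<close>: the generator \<open>u i\<close> must contain a monomial of least degree.
\<close>

lemma finitely_presented_trivial:
  assumes J: "ideal J eps0_algebra"
    and fp: "finitely_presented eps0_algebra eps0_grading (ideal_module eps0_algebra J) (ideal_grading eps0_grading J)"
  shows "J = {\<zero>\<^bsub>eps0_algebra\<^esub>} \<or> J = carrier eps0_algebra"
proof (rule ccontr)
  assume nontrivial: "\<not> ?thesis"
  interpret J: ideal J eps0_algebra by (rule J)
  let ?A = eps0_algebra
  let ?nf = normal_form
  obtain es ds \<phi> \<psi> where
    \<phi>: "\<phi> \<in> graded_hom ?A (free_module ?A es) (free_grading eps0_grading es) (free_module ?A ds) (free_grading eps0_grading ds)"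
    and \<psi>: "\<psi> \<in> graded_hom ?A (free_module ?A ds) (free_grading eps0_grading ds) (ideal_module ?A J) (ideal_grading eps0_grading J)"
    and exact: "\<phi> ` carrier (free_module ?A es) = {x \<in> carrier (free_module ?A ds). \<psi> x = \<zero>\<^bsub>?A\<^esub>}"
    and surj: "\<psi> ` carrier (free_module ?A ds) = J"
    using fp unfolding finitely_presented_def by auto
  let ?E = "free_module ?A es" and ?D = "free_module ?A ds"
  let ?r = "length ds" and ?s = "length es"
  let ?e = "unit_vector ?A ds"
  have e: "?e l \<in> carrier ?D" for l by (auto simp: unit_vector_def)
  define u where "u l = \<psi> (?e l)" for l
  have u_J: "u l \<in> J" for l using surj e by (auto simp: u_def)
  then have u_carrier: "u l \<in> carrier ?A" for l using J.Icarr by blast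
  have \<psi>_expand: "lookup (?nf (\<psi> x)) m = (\<Sum>l<?r. lookup (?nf (x l) * ?nf (u l)) m)"
    if "x \<in> carrier ?D" "m \<in> standard" for x m
    unfolding u_def
  proof (rule normal_form_linear[OF _ _ _ that])
    show "\<psi> x \<in> carrier ?A" if "x \<in> carrier ?D" for x
      using surj that J.Icarr by blast
  qed (use \<psi> in \<open>simp_all add: graded_hom_def del: free_module_simps\<close>)
  have no_constant: "lookup (?nf (u l)) 0 = 0" if "l < ?r" for l
  proof (rule ccontr)
    assume "lookup (?nf (u l)) 0 \<noteq> 0"
    have "\<one>\<^bsub>?A\<^esub> \<in> eps0_grading 0"
      unfolding cls_one eps0_grading_eq by (auto simp: poly_grading_iff of_degree_def exponents_degree_def)
    then have "?e l \<in> free_grading eps0_grading ds (ds ! l)"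
      using zero_in_eps0_grading by (auto simp: free_grading_def unit_vector_def)
    then have "u l \<in> eps0_grading (ds ! l)"
      using \<psi> unfolding graded_hom_def u_def ideal_grading_def by blast
    from homogeneous_with_constant_term[OF this \<open>lookup (?nf (u l)) 0 \<noteq> 0\<close>]
    have "\<one>\<^bsub>?A\<^esub> \<in> J" using u_J[of l] by simp
    then show False using J.one_imp_carrier nontrivial by blast
  qed

  \<comment> \<open>the monomial \<open>m\<close>, occurring in \<open>u i\<close>, has the least degree among all monomials of all generators\<close>
  define deg where "deg m = nat (exponents_degree m)" for m
  have "\<exists>l m. l < ?r \<and> m \<in> keys (?nf (u l))"
  proof (rule ccontr)
    assume none: "\<not> ?thesis"
    have "X = \<zero>\<^bsub>?A\<^esub>" if X: "X \<in> J" for X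
    proof -
      obtain x where x: "x \<in> carrier ?D" "X = \<psi> x" using surj X by blast
      have "?nf (u l) = 0" if "l < ?r" for l using none that by (metis all_not_in_conv keys_eq_empty)
      then have "lookup (?nf X) m = 0" if "m \<in> standard" for m
        using \<psi>_expand[OF x(1) that] by (simp add: x(2))
      then have "keys (?nf X) \<subseteq> vanishing"
        using keys_normal_form[of X] X J.Icarr by (auto simp: in_keys_iff)
      then have "cls (?nf X) = \<zero>\<^bsub>?A\<^esub>" using X J.Icarr by (subst cls_eq_zero_iff) auto
      then show ?thesis using X J.Icarr by simp
    qed
    then have "J = {\<zero>\<^bsub>?A\<^esub>}" using J.zero_closed by blast
    then show False using nontrivial by blast
  qed
  then have "\<exists>lm. fst lm < ?r \<and> snd lm \<in> keys (?nf (u (fst lm)))" by auto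
  then obtain lm where "fst lm < ?r \<and> snd lm \<in> keys (?nf (u (fst lm)))"
      "\<forall>km. fst km < ?r \<and> snd km \<in> keys (?nf (u (fst km))) \<longrightarrow> deg (snd lm) \<le> deg (snd km)"
    using ex_has_least_nat[of "\<lambda>lm. fst lm < ?r \<and> snd lm \<in> keys (?nf (u (fst lm)))" _ "\<lambda>lm. deg (snd lm)"]
    by blast
  then obtain i m where i: "i < ?r" "m \<in> keys (?nf (u i))"
    and minimal: "\<And>l n. l < ?r \<Longrightarrow> n \<in> keys (?nf (u l)) \<Longrightarrow> deg m \<le> deg n"
    by (metis fst_conv snd_conv)
  have m: "m \<in> standard" using i(2) keys_normal_form by blast

  \<comment> \<open>the rows of the presentation matrix are the generating relations\<close>
  define k where "k j l = \<phi> (unit_vector ?A es j) l" for j l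
  have \<phi>_closed: "\<phi> x \<in> carrier ?D" if "x \<in> carrier ?E" for x
    using \<phi> that by (auto simp: graded_hom_def simp del: free_module_simps)
  have k_carrier: "k j l \<in> carrier ?A" if "l < ?r" for j l
  proof -
    have "\<phi> (unit_vector ?A es j) \<in> carrier ?D" by (rule \<phi>_closed) (auto simp: unit_vector_def)
    then show ?thesis using that by (auto simp: k_def)
  qed
  have \<phi>_expand: "lookup (?nf (\<phi> x l)) n = (\<Sum>j<?s. lookup (?nf (x j) * ?nf (k j l)) n)"
    if "x \<in> carrier ?E" "l < ?r" "n \<in> standard" for x l n
    unfolding k_def
  proof (rule normal_form_linear[where f = "\<lambda>x. \<phi> x l"])
    show "\<phi> x l \<in> carrier ?A" if "x \<in> carrier ?E" for x
      using \<phi>_closed[OF that] \<open>l < ?r\<close> by auto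
    show "\<phi> (x \<oplus>\<^bsub>?E\<^esub> y) l = \<phi> x l \<oplus>\<^bsub>?A\<^esub> \<phi> y l" if "x \<in> carrier ?E" "y \<in> carrier ?E" for x y
    proof -
      have "\<phi> (x \<oplus>\<^bsub>?E\<^esub> y) = \<phi> x \<oplus>\<^bsub>?D\<^esub> \<phi> y" using \<phi> that by (simp add: graded_hom_def del: free_module_simps)
      then show ?thesis using \<open>l < ?r\<close> by simp
    qed
    show "\<phi> (a \<odot>\<^bsub>?E\<^esub> x) l = a \<otimes>\<^bsub>?A\<^esub> \<phi> x l" if "a \<in> carrier ?A" "x \<in> carrier ?E" for a x
    proof -
      have "\<phi> (a \<odot>\<^bsub>?E\<^esub> x) = a \<odot>\<^bsub>?D\<^esub> \<phi> x" using \<phi> that by (simp add: graded_hom_def del: free_module_simps)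
      then show ?thesis using \<open>l < ?r\<close> by simp
    qed
  qed (use that in auto)

  \<comment> \<open>all variables that occur in the generators and in the generating relations\<close>
  define T where "T = (\<Union>l<?r. \<Union> (keys ` keys (?nf (u l)))) \<union> (\<Union>l<?r. \<Union>j<?s. \<Union> (keys ` keys (?nf (k j l))))"
  have "finite T" by (auto simp: T_def)
  have keys_sub: "\<Union> (keys ` keys (?nf X)) \<subseteq> {..<\<epsilon>\<^sub>0}" if "X \<in> carrier ?A" for X
    using keys_normal_form by (auto simp: eps0_exponents_def)
  have "T \<subseteq> {..<\<epsilon>\<^sub>0}"
    unfolding T_def using keys_sub u_carrier k_carrier by (intro Un_least UN_least) auto
  with \<open>finite T\<close> obtain \<gamma> where \<gamma>: "\<gamma> < \<epsilon>\<^sub>0" "\<gamma> \<notin> T" "\<And>\<beta>. \<beta> \<in> T \<Longrightarrow> mu \<gamma> \<beta> = 0"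
    using ordinal_with_prescribed_mu[of T "\<lambda>_. 0"] by blast
  have var: "var \<gamma> \<in> eps0_polys" using \<gamma>(1) by (simp add: var_eq_monom)
  let ?x = "cls (var \<gamma>)"

  \<comment> \<open>\<open>x\<^sub>\<gamma>\<close> annihilates every generator, so each \<open>x\<^sub>\<gamma> e\<^sub>i\<close> is a relation\<close>
  have "\<psi> (?x \<odot>\<^bsub>?D\<^esub> ?e i) = ?x \<otimes>\<^bsub>?A\<^esub> u i"
    using \<psi> e[of i] var by (simp add: graded_hom_def u_def del: free_module_simps)
  also have "\<dots> = cls (var \<gamma>) \<otimes>\<^bsub>?A\<^esub> cls (?nf (u i))"
    using u_carrier by simp
  also have "\<dots> = cls (var \<gamma> * ?nf (u i))"
    using u_carrier[of i] var by (intro cls_mult) simp_all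
  also have "\<dots> = \<zero>\<^bsub>?A\<^esub>"
  proof (subst cls_eq_zero_iff)
    show "keys (var \<gamma> * ?nf (u i)) \<subseteq> vanishing"
    proof
      fix n assume "n \<in> keys (var \<gamma> * ?nf (u i))"
      then obtain n' where n': "n' \<in> keys (?nf (u i))" "n = single \<gamma> 1 + n'"
        using keys_mult[of "var \<gamma>" "?nf (u i)"] by (auto simp: var_eq_monom)
      then have "n' \<noteq> 0" using no_constant[OF i(1)] by (auto simp: in_keys_iff)
      then obtain \<beta> where \<beta>: "\<beta> \<in> keys n'" by (metis all_not_in_conv keys_eq_empty)
      then have "\<beta> \<in> T" using n'(1) i(1) by (auto simp: T_def)
      then have "\<gamma> \<noteq> \<beta>" using \<gamma>(2) by blast
      have "1 \<le> lookup n' \<beta>" using \<beta> by (auto simp: in_keys_iff)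
      then have "1 \<le> lookup n \<gamma>" "1 + mu \<gamma> \<beta> \<le> lookup n \<beta>"
        using \<gamma>(3)[OF \<open>\<beta> \<in> T\<close>] by (simp_all add: n'(2) lookup_add)
      moreover have "n \<in> eps0_exponents"
        using n' keys_normal_form \<gamma>(1) by auto
      ultimately show "n \<in> vanishing" unfolding vanishing_def using \<open>\<gamma> \<noteq> \<beta>\<close> by blast
    qed
  qed (use var u_carrier[of i] in simp)
  finally have "?x \<odot>\<^bsub>?D\<^esub> ?e i \<in> {x \<in> carrier ?D. \<psi> x = \<zero>\<^bsub>?A\<^esub>}"
    using var by (auto simp: unit_vector_def)
  then have "?x \<odot>\<^bsub>?D\<^esub> ?e i \<in> \<phi> ` carrier ?E" unfolding exact .
  then obtain c where c: "?x \<odot>\<^bsub>?D\<^esub> ?e i = \<phi> c" "c \<in> carrier ?E"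
    by (rule imageE)
  \<comment> \<open>replacing \<open>c\<close> by its coefficients at \<open>x\<^sub>\<gamma>\<close> yields a relation whose constant part is \<open>e\<^sub>i\<close>\<close>
  define g where "g j = lookup (?nf (c j)) (single \<gamma> 1)" for j
  define c' where "c' = (\<lambda>j\<in>{..<?s}. cls (single 0 (g j)))"
  have g_poly: "single 0 (g j) \<in> eps0_polys" for j
    by (auto simp: eps0_polys_iff)
  have c': "c' \<in> carrier ?E" using g_poly by (auto simp: c'_def)
  have nf_c': "?nf (c' j) = single 0 (g j)" if "j < ?s" for j
    using that zero_standard g_poly by (intro poly_mapping_eqI) (auto simp: c'_def lookup_normal_form_cls lookup_single when_def)
  define a where "a = \<phi> c'"
  have a: "a \<in> carrier ?D" "\<psi> a = \<zero>\<^bsub>?A\<^esub>"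
    using exact c' by (auto simp: a_def simp del: free_module_simps)
  have const_a: "lookup (?nf (a l)) 0 = (if l = i then 1 else 0)" if l: "l < ?r" for l
  proof -
    have "lookup (?nf (a l)) 0 = (\<Sum>j<?s. lookup (?nf (c' j) * ?nf (k j l)) 0)"
      unfolding a_def by (rule \<phi>_expand[OF c' l zero_standard])
    also have "\<dots> = (\<Sum>j<?s. lookup (?nf (c j) * ?nf (k j l)) (single \<gamma> 1))"
    proof (rule sum.cong[OF refl])
      fix j assume j: "j \<in> {..<?s}"
      have "lookup (?nf (c' j) * ?nf (k j l)) (0 + 0) = lookup (?nf (c' j)) 0 * lookup (?nf (k j l)) 0"
        by (rule lookup_mult_unique) simp
      moreover have "lookup (?nf (c j) * ?nf (k j l)) (single \<gamma> 1 + 0) = g j * lookup (?nf (k j l)) 0"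
        unfolding g_def
      proof (rule lookup_mult_unique)
        \<comment> \<open>the entries of \<open>k\<close> do not involve \<open>x\<^sub>\<gamma>\<close>, so \<open>x\<^sub>\<gamma>\<close> must come from \<open>c j\<close>\<close>
        fix x y assume xy: "y \<in> keys (?nf (k j l))" "x + y = single \<gamma> 1 + 0"
        have "lookup y \<beta> = 0" for \<beta>
        proof (cases "\<beta> = \<gamma>")
          case True
          have "keys y \<subseteq> T" using xy(1) j l by (auto simp: T_def)
          then show ?thesis using \<gamma>(2) True by (auto simp: in_keys_iff)
        next
          case False
          then show ?thesis
            using arg_cong[OF xy(2), of "\<lambda>m. lookup m \<beta>"] by (simp add: lookup_add lookup_single)
        qed
        then have "y = 0" by (intro poly_mapping_eqI) simp
        then show "x = single \<gamma> 1 \<and> y = 0" using xy(2) by simp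
      qed
      ultimately show "lookup (?nf (c' j) * ?nf (k j l)) 0 = lookup (?nf (c j) * ?nf (k j l)) (single \<gamma> 1)"
        using nf_c' j by simp
    qed
    also have "\<dots> = lookup (?nf (\<phi> c l)) (single \<gamma> 1)"
      using \<phi>_expand[OF c(2) l pure_power_standard[OF \<gamma>(1)]] by simp
    also have "\<phi> c l = (if l = i then cls (var \<gamma>) else cls 0)"
      using l var by (simp add: c(1)[symmetric] unit_vector_def cls_zero[symmetric])
    also have "lookup (?nf \<dots>) (single \<gamma> 1) = (if l = i then 1 else 0)"
      using var pure_power_standard[OF \<gamma>(1), of 1] by (simp add: lookup_normal_form_cls var_eq_monom lookup_monom)
    finally show ?thesis .
  qed

  \<comment> \<open>by minimality of \<open>m\<close>, only constant terms of \<open>a\<close> contribute to the coefficient of \<open>m\<close> in \<open>\<psi> a\<close>\<close>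
  have "lookup (?nf (a l) * ?nf (u l)) m = (if l = i then lookup (?nf (u i)) m else 0)" if l: "l < ?r" for l
  proof -
    have al: "a l \<in> carrier ?A" using a(1) l by auto
    have "lookup (?nf (a l) * ?nf (u l)) (0 + m) = lookup (?nf (a l)) 0 * lookup (?nf (u l)) m"
    proof (rule lookup_mult_unique)
      fix x y assume xy: "x \<in> keys (?nf (a l))" "y \<in> keys (?nf (u l))" "x + y = 0 + m"
      have "0 \<le> exponents_degree x" "0 \<le> exponents_degree y"
        by (auto simp: exponents_degree_def sum_nonneg)
      moreover have "deg m \<le> deg y" by (rule minimal[OF l xy(2)])
      moreover have "exponents_degree m = exponents_degree x + exponents_degree y"
        using exponents_degree_add[of x y] xy(3) by simp
      ultimately have "exponents_degree x = 0" by (simp add: deg_def)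
      moreover have "x \<in> eps0_exponents" using xy(1) keys_normal_form by blast
      ultimately have "x = 0" by (simp add: exponents_degree_zero_iff)
      then show "x = 0 \<and> y = m" using xy(3) by simp
    qed
    then show ?thesis using const_a[OF l] by simp
  qed
  then have "lookup (?nf (\<psi> a)) m = lookup (?nf (u i)) m"
    using \<psi>_expand[OF a(1) m] i(1) by simp
  moreover have "lookup (?nf (\<psi> a)) m = 0"
    by (simp add: a(2) cls_zero lookup_normal_form_cls)
  ultimately show False using i(2) by (simp add: in_keys_iff)
qed

lemma finitely_presented_zero:
  "finitely_presented eps0_algebra eps0_grading
    (ideal_module eps0_algebra {\<zero>\<^bsub>eps0_algebra\<^esub>}) (ideal_grading eps0_grading {\<zero>\<^bsub>eps0_algebra\<^esub>})"
  unfolding finitely_presented_def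
proof (intro exI bexI conjI)
  let ?F = "free_module eps0_algebra []"
  show "(\<lambda>x. x) \<in> graded_hom eps0_algebra ?F (free_grading eps0_grading []) ?F (free_grading eps0_grading [])"
    by (simp add: graded_hom_def)
  show "(\<lambda>_. \<zero>\<^bsub>eps0_algebra\<^esub>) \<in> graded_hom eps0_algebra ?F (free_grading eps0_grading [])
      (ideal_module eps0_algebra {\<zero>\<^bsub>eps0_algebra\<^esub>}) (ideal_grading eps0_grading {\<zero>\<^bsub>eps0_algebra\<^esub>})"
    using zero_in_eps0_grading by (auto simp: graded_hom_def ideal_grading_def)
qed auto

lemma finitely_presented_carrier:
  "finitely_presented eps0_algebra eps0_grading
    (ideal_module eps0_algebra (carrier eps0_algebra)) (ideal_grading eps0_grading (carrier eps0_algebra))"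
  unfolding finitely_presented_def
proof (intro exI bexI conjI)
  let ?A = eps0_algebra
  let ?E = "free_module ?A []" and ?F = "free_module ?A [0]"
  let ?N = "ideal_module ?A (carrier ?A)"
  show "(\<lambda>_. \<lambda>i\<in>{..<length [0 :: int]}. \<zero>\<^bsub>?A\<^esub>) \<in>
      graded_hom ?A ?E (free_grading eps0_grading []) ?F (free_grading eps0_grading [0])"
    using zero_in_eps0_grading by (auto simp: graded_hom_def free_grading_def fun_eq_iff restrict_def)
  show "(\<lambda>x. x 0) \<in> graded_hom ?A ?F (free_grading eps0_grading [0])
      ?N (ideal_grading eps0_grading (carrier ?A))"
    unfolding graded_hom_def
  proof (intro CollectI conjI ballI allI)
    show "(\<lambda>x. x 0) ` free_grading eps0_grading [0] d \<subseteq> ideal_grading eps0_grading (carrier ?A) d" for d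
    proof safe
      fix x assume "x \<in> free_grading eps0_grading [0] d"
      then have "x 0 \<in> eps0_grading d" by (auto simp: free_grading_def PiE_iff)
      then show "x 0 \<in> ideal_grading eps0_grading (carrier ?A) d"
        using eps0_grading_carrier by (auto simp: ideal_grading_def)
    qed
  qed auto
  show "(\<lambda>_. \<lambda>i\<in>{..<length [0 :: int]}. \<zero>\<^bsub>?A\<^esub>) ` carrier ?E = {x \<in> carrier ?F. x 0 = \<zero>\<^bsub>?N\<^esub>}"
    by (auto simp: PiE_iff extensional_def fun_eq_iff restrict_def)
  show "(\<lambda>x. x 0) ` carrier ?F = carrier ?N"
  proof
    show "carrier ?N \<subseteq> (\<lambda>x. x 0) ` carrier ?F"
    proof
      fix X assume "X \<in> carrier ?N"
      then show "X \<in> (\<lambda>x. x 0) ` carrier ?F"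
        by (intro image_eqI[of _ _ "\<lambda>i\<in>{..<length [0 :: int]}. X"]) auto
    qed
  qed auto
qed

theorem totally_incoherent_eps0_algebra: "totally_incoherent eps0_algebra eps0_grading"
proof -
  let ?Z = "{\<zero>\<^bsub>eps0_algebra\<^esub>}" and ?C = "carrier eps0_algebra"
  have "homogeneous_ideal eps0_algebra eps0_grading ?Z"
    using zero_in_eps0_grading eps0_algebra.genideal_zero eps0_algebra.zeroideal
    by (auto simp: homogeneous_ideal_def homogeneous_elements_def Int_absorb2)
  moreover have "homogeneous_ideal eps0_algebra eps0_grading ?C"
  proof -
    let ?G = "genideal eps0_algebra (?C \<inter> homogeneous_elements eps0_grading)"
    have "\<one>\<^bsub>eps0_algebra\<^esub> \<in> eps0_grading 0"
      unfolding cls_one eps0_grading_eq by (auto simp: poly_grading_iff of_degree_def exponents_degree_def)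
    then have "\<one>\<^bsub>eps0_algebra\<^esub> \<in> ?C \<inter> homogeneous_elements eps0_grading"
      by (auto simp: homogeneous_elements_def)
    then have "\<one>\<^bsub>eps0_algebra\<^esub> \<in> ?G"
      using eps0_algebra.genideal_self[of "?C \<inter> homogeneous_elements eps0_grading"] by blast
    moreover have "ideal ?G eps0_algebra" by (rule eps0_algebra.genideal_ideal) simp
    ultimately have "?G = ?C" by (metis ideal.one_imp_carrier)
    then show ?thesis using eps0_algebra.oneideal by (simp add: homogeneous_ideal_def)
  qed
  ultimately show ?thesis
    unfolding totally_incoherent_def
    using finitely_presented_trivial finitely_presented_zero finitely_presented_carrier
    by (auto simp: homogeneous_ideal_def)
qed

section \<open>The reduced quotient\<close>

text \<open>
  The Frobenius homomorphism: the mixed terms of a square occur twice.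
\<close>

lemma square_sum_monom:
  "finite S \<Longrightarrow> (\<Sum>m\<in>S. monom m) * (\<Sum>m\<in>S. monom m) = (\<Sum>m\<in>S. monom (m + m))"
proof (induction S rule: finite_induct)
  case (insert n S)
  let ?s = "\<Sum>m\<in>S. monom m"
  have "(monom n + ?s) * (monom n + ?s) = monom n * monom n + ?s * ?s + (monom n * ?s + monom n * ?s)"
    by (simp only: distrib_left distrib_right mult.commute add_ac)
  also have "\<dots> = monom n * monom n + ?s * ?s" by (simp only: double_poly add_0_right)
  finally show ?case using insert by (simp add: monom_mult)
qed simp

lemma keys_square: "keys (p * p) = (\<lambda>m. m + m) ` keys p" for p :: polynomial
proof -
  let ?d = "\<lambda>m :: exponents. m + m"
  have inj: "inj_on ?d (keys p)"
  proof (intro inj_onI poly_mapping_eqI)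
    fix m n :: exponents and \<alpha>
    assume "m + m = n + n"
    from arg_cong[OF this, of "\<lambda>m. lookup m \<alpha>"] show "lookup m \<alpha> = lookup n \<alpha>"
      by (simp add: lookup_add)
  qed
  have "p * p = (\<Sum>m\<in>keys p. monom (?d m))"
    using square_sum_monom[of "keys p"] by (simp flip: poly_eq_sum_monom)
  also have "\<dots> = (\<Sum>n\<in>?d ` keys p. monom n)"
    by (simp add: sum.reindex[OF inj])
  finally have "lookup (p * p) n = (if n \<in> ?d ` keys p then 1 else 0)" for n
    by (simp add: lookup_sum lookup_monom)
  then show ?thesis by (auto simp: in_keys_iff split: if_splits)
qed

lemma lookup_multiple: "lookup (\<Sum>_<(n :: nat). m) \<alpha> = n * lookup m \<alpha>" for m :: exponents
  by (simp only: lookup_sum) simp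

text \<open>
  The sum of \<open>2^j\<close> copies of \<open>m\<close> is the exponent vector of the \<open>2^j\<close>-th power of the monomial \<open>m\<close>.
\<close>

lemma keys_power_of_two:
  "keys (p ^ 2 ^ j) = (\<lambda>m. \<Sum>_<(2 ^ j :: nat). m) ` keys p" for p :: polynomial
proof (induction j)
  case (Suc j)
  have "(\<Sum>_<(2 ^ Suc j :: nat). m) = (\<Sum>_<(2 ^ j :: nat). m) + (\<Sum>_<(2 ^ j :: nat). m)" for m :: exponents
    by (rule poly_mapping_eqI) (simp only: lookup_add lookup_multiple power_Suc mult_2 distrib_right)
  moreover have "p ^ 2 ^ Suc j = p ^ 2 ^ j * p ^ 2 ^ j"
    by (simp add: mult_2 power_add)
  ultimately show ?case
    by (simp only: keys_square Suc.IH image_image)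
qed simp

lemma eps0_algebra_pow:
  assumes "p \<in> eps0_polys"
  shows "cls p [^]\<^bsub>eps0_algebra\<^esub> (n :: nat) = cls (p ^ n)" "p ^ n \<in> eps0_polys"
proof -
  have "p ^ n \<in> eps0_polys \<and> cls p [^]\<^bsub>eps0_algebra\<^esub> n = cls (p ^ n)"
    by (induction n) (use assms in \<open>auto simp: cls_one cls_mult mult.commute\<close>)
  then show "cls p [^]\<^bsub>eps0_algebra\<^esub> n = cls (p ^ n)" "p ^ n \<in> eps0_polys" by auto
qed

text \<open>
  By \<open>keys_power_of_two\<close>, both inclusions can be checked on single monomials. A large power of a
  mixed monomial vanishes, and a monomial in at most one variable has no vanishing power.
\<close>

lemma nilradical_eps0_algebra: "nilradical eps0_algebra = cls ` reduced_ideal"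
proof
  show "nilradical eps0_algebra \<subseteq> cls ` reduced_ideal"
  proof
    fix X assume "X \<in> nilradical eps0_algebra"
    then obtain p n where p: "p \<in> eps0_polys" "X = cls p" "X [^]\<^bsub>eps0_algebra\<^esub> (n :: nat) = \<zero>\<^bsub>eps0_algebra\<^esub>"
      by (auto simp: nilradical_def carrier_eps0_algebra)
    then have "keys (p ^ n) \<subseteq> vanishing"
      using eps0_algebra_pow[OF p(1), of n] by (simp flip: cls_eq_zero_iff)
    then have "p ^ n \<in> eps0_ideal"
      by (simp add: eps0_ideal_eq)
    moreover have "p ^ (2 ^ n - n) \<in> eps0_polys" by (rule eps0_algebra_pow(2)[OF p(1)])
    ultimately have "p ^ n * p ^ (2 ^ n - n) \<in> eps0_ideal"
      using ideal.I_r_closed[OF ideal_eps0_ideal] by force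
    moreover have "p ^ n * p ^ (2 ^ n - n) = p ^ 2 ^ n"
      by (simp flip: power_add)
    ultimately have "keys (p ^ 2 ^ n) \<subseteq> mixed"
      using vanishing_subset_mixed by (auto simp: eps0_ideal_eq)
    have "m \<in> mixed" if m: "m \<in> keys p" for m
    proof -
      have "(\<Sum>_<(2 ^ n :: nat). m) \<in> mixed"
        using \<open>keys (p ^ 2 ^ n) \<subseteq> mixed\<close> m unfolding keys_power_of_two by blast
      then obtain \<alpha> \<beta> where "\<alpha> \<noteq> \<beta>" "1 \<le> 2 ^ n * lookup m \<alpha>" "1 \<le> 2 ^ n * lookup m \<beta>"
        unfolding mixed_def by (auto simp only: lookup_multiple mem_Collect_eq)
      then have "1 \<le> lookup m \<alpha>" "1 \<le> lookup m \<beta>" by auto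
      moreover have "m \<in> eps0_exponents" using m p(1) by (auto simp: eps0_polys_iff)
      ultimately show ?thesis using \<open>\<alpha> \<noteq> \<beta>\<close> unfolding mixed_def by blast
    qed
    then show "X \<in> cls ` reduced_ideal" using p(2) by (auto simp: reduced_ideal_eq)
  qed
  show "cls ` reduced_ideal \<subseteq> nilradical eps0_algebra"
  proof safe
    fix p assume "p \<in> reduced_ideal"
    then have p: "keys p \<subseteq> mixed" by (simp add: reduced_ideal_eq)
    then have P: "p \<in> eps0_polys" by (auto simp: eps0_polys_iff mixed_def)
    have "\<forall>m\<in>keys p. \<exists>N. \<exists>\<alpha> \<beta>. \<alpha> \<noteq> \<beta> \<and> 1 \<le> lookup m \<alpha> \<and> 1 \<le> lookup m \<beta> \<and> mu \<alpha> \<beta> < N"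
      using p unfolding mixed_def by blast
    then obtain N where N: "\<forall>m\<in>keys p. \<exists>\<alpha> \<beta>. \<alpha> \<noteq> \<beta> \<and> 1 \<le> lookup m \<alpha> \<and> 1 \<le> lookup m \<beta> \<and> mu \<alpha> \<beta> < N m"
      by metis
    define j where "j = Max (insert 0 (N ` keys p))"
    have "keys (p ^ 2 ^ j) \<subseteq> vanishing"
    proof
      fix n assume "n \<in> keys (p ^ 2 ^ j)"
      then obtain m where m: "m \<in> keys p" "n = (\<Sum>_<(2 ^ j :: nat). m)"
        unfolding keys_power_of_two by blast
      then obtain \<alpha> \<beta> where *: "\<alpha> \<noteq> \<beta>" "1 \<le> lookup m \<alpha>" "1 \<le> lookup m \<beta>" "mu \<alpha> \<beta> < N m"
        using N by blast
      have "N m \<le> j" using m(1) by (auto simp: j_def)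
      then have "1 + mu \<alpha> \<beta> \<le> 2 ^ j" using *(4) less_exp[of j] by linarith
      also have "2 ^ j * 1 \<le> 2 ^ j * lookup m \<beta>" using *(3) by (intro mult_left_mono) auto
      finally have "1 + mu \<alpha> \<beta> \<le> lookup n \<beta>" by (simp only: m(2) lookup_multiple mult_1_right)
      moreover have "1 \<le> lookup n \<alpha>" using *(2) by (simp only: m(2) lookup_multiple) simp
      moreover have "n \<in> eps0_exponents"
        using eps0_algebra_pow(2)[OF P, of "2 ^ j"] \<open>n \<in> keys (p ^ 2 ^ j)\<close> by (auto simp: eps0_polys_iff)
      ultimately show "n \<in> vanishing" unfolding vanishing_def using *(1) by blast
    qed
    then have "cls p [^]\<^bsub>eps0_algebra\<^esub> ((2 :: nat) ^ j) = \<zero>\<^bsub>eps0_algebra\<^esub>"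
      using eps0_algebra_pow[OF P, of "2 ^ j"] by (simp add: cls_eq_zero_iff)
    then show "cls p \<in> nilradical eps0_algebra"
      using P unfolding nilradical_def by (intro CollectI conjI exI) simp_all
  qed
qed

abbreviation red :: "polynomial \<Rightarrow> polynomial set"
  where "red p \<equiv> reduced_ideal +>\<^bsub>poly_ring\<^esub> p"

text \<open>
  The canonical projection onto the reduced algebra; the relations of the \<open>\<epsilon>\<^sub>0\<close>-algebra hold there
  because \<open>vanishing \<subseteq> mixed\<close>.
\<close>

definition reduction :: "polynomial set \<Rightarrow> polynomial set"
  where "reduction X = red (normal_form X)"

lemma reduced_ideal_hom: "ring_hom_ring poly_ring reduced_algebra red"
  unfolding reduced_algebra_def by (rule ideal.rcos_ring_hom_ring[OF ideal_reduced_ideal])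

lemma red_eq_iff: "p \<in> eps0_polys \<Longrightarrow> q \<in> eps0_polys \<Longrightarrow> red p = red q \<longleftrightarrow> p + q \<in> reduced_ideal"
  using poly_ring.quotient_eq_iff_same_a_r_cos[OF ideal_reduced_ideal, of p q] by (simp add: poly_ring_minus)

lemma reduction_cls:
  assumes "p \<in> eps0_polys"
  shows "reduction (cls p) = red p"
proof -
  have "cls (normal_form (cls p)) = cls p" using assms by simp
  then have "normal_form (cls p) + p \<in> eps0_ideal"
    using poly_ring.quotient_eq_iff_same_a_r_cos[OF ideal_eps0_ideal, of "normal_form (cls p)" p] assms
    by (simp add: poly_ring_minus)
  then have "normal_form (cls p) + p \<in> reduced_ideal"
    using vanishing_subset_mixed by (auto simp: eps0_ideal_eq reduced_ideal_eq)
  then show ?thesis using assms by (simp add: reduction_def red_eq_iff)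
qed

lemma reduction_hom: "ring_hom_ring eps0_algebra reduced_algebra reduction"
proof -
  interpret red: ring_hom_ring poly_ring reduced_algebra red by (rule reduced_ideal_hom)
  show ?thesis
  proof (rule ring_hom_ringI)
    show "ring eps0_algebra" "ring reduced_algebra" by (fact eps0_algebra.ring_axioms red.S.ring_axioms)+
    show "reduction X \<in> carrier reduced_algebra" if "X \<in> carrier eps0_algebra" for X
      using that red.hom_closed by (simp add: reduction_def)
    show "reduction \<one>\<^bsub>eps0_algebra\<^esub> = \<one>\<^bsub>reduced_algebra\<^esub>"
      using red.hom_one by (simp add: cls_one reduction_cls)
    fix X Y assume "X \<in> carrier eps0_algebra" "Y \<in> carrier eps0_algebra"
    then obtain p q where pq: "p \<in> eps0_polys" "X = cls p" "q \<in> eps0_polys" "Y = cls q"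
      by (auto simp: carrier_eps0_algebra)
    then show "reduction (X \<otimes>\<^bsub>eps0_algebra\<^esub> Y) = reduction X \<otimes>\<^bsub>reduced_algebra\<^esub> reduction Y"
      and "reduction (X \<oplus>\<^bsub>eps0_algebra\<^esub> Y) = reduction X \<oplus>\<^bsub>reduced_algebra\<^esub> reduction Y"
      using red.hom_mult[of p q] red.hom_add[of p q] by (simp_all add: cls_mult cls_add reduction_cls)
  qed
qed

lemma kernel_reduction: "a_kernel eps0_algebra reduced_algebra reduction = nilradical eps0_algebra"
proof -
  have zero: "\<zero>\<^bsub>reduced_algebra\<^esub> = red 0"
    using poly_ring.a_rcos_zero[OF ideal_reduced_ideal] by (simp add: reduced_algebra_def FactRing_def reduced_ideal_eq)
  have sub: "reduced_ideal \<subseteq> eps0_polys"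
    by (auto simp: reduced_ideal_eq eps0_polys_iff mixed_def)
  have "reduction (cls p) = \<zero>\<^bsub>reduced_algebra\<^esub> \<longleftrightarrow> p \<in> reduced_ideal" if "p \<in> eps0_polys" for p
    using that red_eq_iff[of p 0] by (simp add: reduction_cls zero)
  then show ?thesis
    unfolding a_kernel_def' nilradical_eps0_algebra carrier_eps0_algebra using sub by auto
qed

theorem reduced_quotient:
  "\<exists>\<phi> \<in> graded_ring_iso
      (eps0_algebra Quot nilradical eps0_algebra)
      (quotient_grading eps0_algebra (nilradical eps0_algebra) eps0_grading)
      reduced_algebra reduced_grading.
    \<forall>\<alpha><\<epsilon>\<^sub>0. \<phi> (nilradical eps0_algebra +>\<^bsub>eps0_algebra\<^esub> eps0_var \<alpha>) = reduced_var \<alpha>"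
proof -
  interpret h: ring_hom_ring eps0_algebra reduced_algebra reduction by (rule reduction_hom)
  let ?\<phi> = "\<lambda>X. the_elem (reduction ` X)"
  have \<phi>: "?\<phi> (nilradical eps0_algebra +>\<^bsub>eps0_algebra\<^esub> cls p) = red p" if "p \<in> eps0_polys" for p
    using h.the_elem_simp[of "cls p"] that by (simp add: kernel_reduction reduction_cls)
  have "reduction ` carrier eps0_algebra = carrier reduced_algebra"
    unfolding carrier_eps0_algebra
    by (force simp: reduced_algebra_def FactRing_def A_RCOSETS_def' reduction_cls image_image)
  then have "?\<phi> \<in> ring_iso (eps0_algebra Quot nilradical eps0_algebra) reduced_algebra"
    using h.FactRing_iso_set by (simp add: kernel_reduction)
  moreover have "?\<phi> ` quotient_grading eps0_algebra (nilradical eps0_algebra) eps0_grading d = reduced_grading d" for d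
  proof -
    have "?\<phi> ` quotient_grading eps0_algebra (nilradical eps0_algebra) eps0_grading d = red ` poly_grading d"
      unfolding quotient_grading_def eps0_grading_eq image_image
      by (rule image_cong[OF refl]) (simp add: \<phi> poly_grading_eps0_polys)
    then show ?thesis by (simp add: reduced_grading_def quotient_grading_def)
  qed
  moreover have "?\<phi> (nilradical eps0_algebra +>\<^bsub>eps0_algebra\<^esub> eps0_var \<alpha>) = reduced_var \<alpha>" if "\<alpha> < \<epsilon>\<^sub>0" for \<alpha>
    using \<phi>[of "var \<alpha>"] that by (simp add: eps0_var_def reduced_var_def var_eq_monom)
  ultimately show ?thesis
    unfolding graded_ring_iso_def by (intro bexI[of _ ?\<phi>]) auto
qed

section \<open>Annihilator and finiteness properties of the \<open>\<epsilon>\<^sub>0\<close>-algebra\<close>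

theorem theorem1p20:
  shows "(\<forall>S. finite S \<and> S \<subseteq> eps0_monomials \<longrightarrow>
            genideal eps0_algebra S =
              annihilator eps0_algebra (annihilator eps0_algebra (genideal eps0_algebra S))) \<and>
         (\<exists>J. finitely_generated_ideal eps0_algebra eps0_grading J \<and> \<not> monomial_ideal J \<and>
            J \<noteq> annihilator eps0_algebra (annihilator eps0_algebra J)) \<and>
         \<not> double_annihilator_condition eps0_algebra eps0_grading \<and>
         \<not> self_injective eps0_algebra eps0_grading \<and>
         totally_incoherent eps0_algebra eps0_grading \<and>
         (\<exists>\<phi> \<in> graded_ring_iso
              (eps0_algebra Quot nilradical eps0_algebra)
              (quotient_grading eps0_algebra (nilradical eps0_algebra) eps0_grading)
              reduced_algebra reduced_grading.
            \<forall>\<alpha><\<epsilon>\<^sub>0. \<phi> (nilradical eps0_algebra +>\<^bsub>eps0_algebra\<^esub> eps0_var \<alpha>) = reduced_var \<alpha>)"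
proof (intro conjI allI impI)
  obtain a b where "obstructing_binomial a b"
    using obstructing_binomial_exists by blast
  then interpret obstructing_binomial a b .
  show "genideal eps0_algebra S =
      annihilator eps0_algebra (annihilator eps0_algebra (genideal eps0_algebra S))"
    if "finite S \<and> S \<subseteq> eps0_monomials" for S
    using that monomial_double_annihilator by blast
  show "\<exists>J. finitely_generated_ideal eps0_algebra eps0_grading J \<and> \<not> monomial_ideal J \<and>
      J \<noteq> annihilator eps0_algebra (annihilator eps0_algebra J)"
    using finitely_generated_J not_monomial_J J_not_double_annihilator by blast
  show "\<not> double_annihilator_condition eps0_algebra eps0_grading"
    using finitely_generated_J J_not_double_annihilator
    unfolding double_annihilator_condition_def by metis
qed (fact not_self_injective_eps0_algebra totally_incoherent_eps0_algebra reduced_quotient)+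

end
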